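(* There is an absolute constant $c>0$ and a deterministic LOCAL algorithm with the following property. Let $H=(V,E)$ be a hypergraph of rank at most $r$ and maximum degree at most $\Delta$, with an edge-weighting $a:E\to[0,\infty)$. Suppose the algorithm is also given a good coloring of $H$. Then it runs in $\tilde O(r\log\Delta+\log^2\Delta)$ rounds and outputs a matching $M$ of $H$ with $a(M)\ge c\,a^*(H)/r$. If no good coloring is given, the same guarantee holds with round complexity $\tilde O(r\log\Delta+\log^2\Delta+\log^* n)$.
   Context: **Hypergraph notation.** For a hypergraph $H=(V,E)$: - $E$ may be a multiset. - $N(v)$ is the set of edges containing vertex $v$, and $\deg(v)=|N(v)|$. - The rank is the maximum edge size. - A matching is a set of pairwise disjoint edges. **Weights.** An edge-weighting is a function $a:E\to[0,\infty)$, and for $L\subseteq E$ we write $a(L)=\sum_{e\in L}a(e)$. **Fractional matchings.** A fractional matching is a function $h:E\to[0,1]$ with $\sum_{e\in N(v)}h(e)\le 1$ for all $v$. Its weight is $a(h)=\sum_e a(e)h(e)$. Then $a^*(H)$ denotes the maximum of $a(h)$ over all fractional matchings $h$. **LOCAL model on hypergraphs.** The incidence graph $\mathrm{Inc}(H)$ is the bipartite graph with one node per vertex of $H$ and one node per edge of $H$, where the node of $v$ is adjacent to the node of $e$ iff $v\in e$. Computation proceeds in synchronous rounds: - In each round, every node of $\mathrm{Inc}(H)$ may do unbounded local computation and send messages of unbounded size to its neighbours in $\mathrm{Inc}(H)$. - In the deterministic variant, nodes have unique $O(\log n)$-bit IDs. - Global upper bounds $n\ge|V|$, $\Delta\ge\max_v\deg(v)$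 and $r\ge\max_e|e|$ (with $r\ge2$) are known to all nodes. - At the end, each node outputs its part of the solution; for example, each edge outputs whether it is in $M$. **Good coloring.** A good coloring of $H$ is a proper vertex coloring of $\mathrm{Inc}(H)^2$ using $\mathrm{poly}(r,\Delta)$ colors. Here $G^2$ is the graph on the same node set with $u,v$ adjacent iff their distance in $G$ is at most 2. **Notation.** $\tilde O(x)$ denotes $x\cdot\mathrm{polylog}(x)$. *)

theory Defs
  imports Complex_Main "HOL-Library.Multiset"
begin

text \<open>A hypergraph is given by a finite vertex set V, a finite set E of edge
  indices and an incidence map inc (edge index to its vertex set).  Using edge
  indices allows E to be a multiset of vertex sets.\<close>

definition hypergraph :: "nat set \<Rightarrow> nat set \<Rightarrow> (nat \<Rightarrow> nat set) \<Rightarrow> bool" where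
  "hypergraph V E inc \<longleftrightarrow> finite V \<and> finite E \<and> (\<forall>e\<in>E. inc e \<subseteq> V)"

definition edges_at :: "nat set \<Rightarrow> (nat \<Rightarrow> nat set) \<Rightarrow> nat \<Rightarrow> nat set" where
  "edges_at E inc v = {e\<in>E. v \<in> inc e}"

definition hdeg :: "nat set \<Rightarrow> (nat \<Rightarrow> nat set) \<Rightarrow> nat \<Rightarrow> nat" where
  "hdeg E inc v = card (edges_at E inc v)"

definition is_matching :: "nat set \<Rightarrow> (nat \<Rightarrow> nat set) \<Rightarrow> nat set \<Rightarrow> bool" where
  "is_matching E inc M \<longleftrightarrow> M \<subseteq> E \<and> (\<forall>e\<in>M. \<forall>e'\<in>M. e \<noteq> e' \<longrightarrow> inc e \<inter> inc e' = {})"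

definition weight :: "(nat \<Rightarrow> real) \<Rightarrow> nat set \<Rightarrow> real" where
  "weight a L = (\<Sum>e\<in>L. a e)"

definition frac_matching :: "nat set \<Rightarrow> nat set \<Rightarrow> (nat \<Rightarrow> nat set) \<Rightarrow> (nat \<Rightarrow> real) \<Rightarrow> bool" where
  "frac_matching V E inc h \<longleftrightarrow>
     (\<forall>e\<in>E. 0 \<le> h e \<and> h e \<le> 1) \<and> (\<forall>v\<in>V. (\<Sum>e\<in>edges_at E inc v. h e) \<le> 1)"

text \<open>a*(H): maximum weight of a fractional matching (the supremum is attained).\<close>
definition frac_opt :: "nat set \<Rightarrow> nat set \<Rightarrow> (nat \<Rightarrow> nat set) \<Rightarrow> (nat \<Rightarrow> real) \<Rightarrow> real" where
  "frac_opt V E inc a = Sup {(\<Sum>e\<in>E. a e * h e) | h. frac_matching V E inc h}"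

definition inc_nodes :: "nat set \<Rightarrow> nat set \<Rightarrow> (nat + nat) set" where
  "inc_nodes V E = Inl ` V \<union> Inr ` E"

definition inc_adj :: "nat set \<Rightarrow> nat set \<Rightarrow> (nat \<Rightarrow> nat set) \<Rightarrow> nat + nat \<Rightarrow> nat + nat \<Rightarrow> bool" where
  "inc_adj V E inc x y \<longleftrightarrow>
     (\<exists>v\<in>V. \<exists>e\<in>E. v \<in> inc e \<and> ((x = Inl v \<and> y = Inr e) \<or> (x = Inr e \<and> y = Inl v)))"

definition inc_nbrs :: "nat set \<Rightarrow> nat set \<Rightarrow> (nat \<Rightarrow> nat set) \<Rightarrow> nat + nat \<Rightarrow> (nat + nat) set" where
  "inc_nbrs V E inc x = {y \<in> inc_nodes V E. inc_adj V E inc x y}"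

definition inc_sq_adj :: "nat set \<Rightarrow> nat set \<Rightarrow> (nat \<Rightarrow> nat set) \<Rightarrow> nat + nat \<Rightarrow> nat + nat \<Rightarrow> bool" where
  "inc_sq_adj V E inc x y \<longleftrightarrow> x \<noteq> y \<and>
     (inc_adj V E inc x y \<or> (\<exists>z \<in> inc_nodes V E. inc_adj V E inc x z \<and> inc_adj V E inc z y))"

text \<open>Good coloring: proper coloring of Inc(H)^2 with fewer than (r+\<Delta>)^d colors,
  i.e. poly(r,\<Delta>) colors, the polynomial being fixed by the exponent d.\<close>
definition good_coloring :: "nat \<Rightarrow> nat set \<Rightarrow> nat set \<Rightarrow> (nat \<Rightarrow> nat set) \<Rightarrow> nat \<Rightarrow> nat
    \<Rightarrow> (nat + nat \<Rightarrow> nat) \<Rightarrow> bool" where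
  "good_coloring d V E inc r \<Delta> col \<longleftrightarrow>
     (\<forall>x\<in>inc_nodes V E. col x < (r + \<Delta>) ^ d) \<and>
     (\<forall>x\<in>inc_nodes V E. \<forall>y\<in>inc_nodes V E. inc_sq_adj V E inc x y \<longrightarrow> col x \<noteq> col y)"

text \<open>Local input of a node: for a vertex node its ID and (optional) color; for an
  edge node its ID, (optional) color and weight.\<close>
datatype ninput = VtxIn nat "nat option" | EdgIn nat "nat option" real

text \<open>The state of a node after t rounds of full-information broadcast: its own
  input together with the multiset of its neighbours' states after t-1 rounds.
  Since computation and messages are unbounded, every t-round LOCAL algorithm
  computes its output as a function of this view (and the known globals).\<close>
datatype lview = LV ninput "lview multiset"

fun view :: "(nat + nat \<Rightarrow> ninput) \<Rightarrow> (nat + nat \<Rightarrow> (nat + nat) set) \<Rightarrow> nat \<Rightarrow> nat + nat \<Rightarrow> lview" where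
  "view inp nb 0 x = LV (inp x) {#}"
| "view inp nb (Suc t) x = LV (inp x) (image_mset (view inp nb t) (mset_set (nb x)))"

definition local_input :: "(nat + nat \<Rightarrow> nat) \<Rightarrow> (nat + nat \<Rightarrow> nat option) \<Rightarrow> (nat \<Rightarrow> real)
    \<Rightarrow> nat + nat \<Rightarrow> ninput" where
  "local_input ids col a x = (case x of Inl v \<Rightarrow> VtxIn (ids x) (col x) | Inr e \<Rightarrow> EdgIn (ids x) (col x) (a e))"

text \<open>Output of a LOCAL algorithm (T, out): with known globals n, \<Delta>, r it runs
  T n \<Delta> r rounds; edge node e outputs out n \<Delta> r (its view), meaning "e \<in> M".\<close>
definition local_output :: "(nat \<Rightarrow> nat \<Rightarrow> nat \<Rightarrow> nat) \<Rightarrow> (nat \<Rightarrow> nat \<Rightarrow> nat \<Rightarrow> lview \<Rightarrow> bool)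
    \<Rightarrow> nat \<Rightarrow> nat \<Rightarrow> nat \<Rightarrow> nat set \<Rightarrow> nat set \<Rightarrow> (nat \<Rightarrow> nat set)
    \<Rightarrow> (nat + nat \<Rightarrow> nat) \<Rightarrow> (nat + nat \<Rightarrow> nat option) \<Rightarrow> (nat \<Rightarrow> real) \<Rightarrow> nat set" where
  "local_output T out n \<Delta> r V E inc ids col a =
     {e\<in>E. out n \<Delta> r (view (local_input ids col a) (inc_nbrs V E inc) (T n \<Delta> r) (Inr e))}"

text \<open>Valid instance: hypergraph with rank \<le> r, max degree \<le> \<Delta>, |V| \<le> n, r \<ge> 2,
  nonnegative weights, unique IDs of O(log n) bits (IDs < n^k).\<close>
definition valid_instance :: "nat \<Rightarrow> nat \<Rightarrow> nat \<Rightarrow> nat \<Rightarrow> nat set \<Rightarrow> nat set \<Rightarrow> (nat \<Rightarrow> nat set)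
    \<Rightarrow> (nat \<Rightarrow> real) \<Rightarrow> (nat + nat \<Rightarrow> nat) \<Rightarrow> bool" where
  "valid_instance k n \<Delta> r V E inc a ids \<longleftrightarrow>
     hypergraph V E inc \<and> 2 \<le> r \<and> card V \<le> n \<and>
     (\<forall>e\<in>E. card (inc e) \<le> r) \<and> (\<forall>v\<in>V. hdeg E inc v \<le> \<Delta>) \<and>
     (\<forall>e\<in>E. 0 \<le> a e) \<and>
     inj_on ids (inc_nodes V E) \<and> (\<forall>x\<in>inc_nodes V E. ids x < n ^ k)"

definition log_star :: "nat \<Rightarrow> nat" where
  "log_star n = (LEAST i. ((\<lambda>x. log 2 x) ^^ i) (real n) \<le> 1)"

definition soft_O_bound :: "real \<Rightarrow> nat \<Rightarrow> real \<Rightarrow> real" where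
  "soft_O_bound K j x = K * x * (log 2 (x + 2)) ^ j"

text \<open>r log \<Delta> + log^2 \<Delta>, with log \<Delta> read as log (\<Delta>+2) to avoid degenerate small values.\<close>
definition base_term :: "nat \<Rightarrow> nat \<Rightarrow> real" where
  "base_term \<Delta> r = real r * log 2 (real \<Delta> + 2) + (log 2 (real \<Delta> + 2)) ^ 2"

end

theory Submission
  imports Defs "HOL-Library.FuncSet"
begin

text \<open>Everything happens on the line graph of \<open>H\<close>, whose degree is at most \<open>r * \<Delta>\<close>.

  Start with \<open>x e = 2^-k\<close> on all edges, where \<open>k\<close> is about \<open>log (r * \<Delta>)\<close>, and repeatedly double \<open>x e\<close>
  as long as the load \<open>\<Sum> a f * x f\<close> over the closed neighbourhood of \<open>e\<close> is below \<open>a e / 4\<close>. After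
  \<open>k\<close> rounds all loads are at least \<open>a e / 4\<close>, so \<open>A = \<Sum> a e * x e\<close> is at least \<open>a* / (4 * r)\<close> by
  double counting against a fractional matching; yet the total conflict
  \<open>Q = \<Sum> min (a e) (a f) * x e * x f\<close> over ordered pairs of adjacent edges is at most \<open>3/4 * A\<close>.
  No bucketing of weights is needed: an edge may become overloaded by heavier edges after it has
  stopped, but every doubling adds to \<open>Q\<close> at most \<open>3/4\<close> of what it adds to \<open>A\<close>.

  The functional \<open>A - l * Q\<close> involves only pairs, so it can be rounded locally: in each of \<open>k\<close> phases
  every fractional edge is doubled or dropped by the method of conditional expectations, run along
  a colouring with about \<open>k\<close> colours (up to logarithmic factors) whose monochromatic pairs carry at
  most a \<open>1/(6 * k)\<close> fraction of \<open>Q\<close>. Lowering \<open>l\<close> from \<open>1\<close> to \<open>1/2\<close> in steps of \<open>1/(2 * k)\<close> pays for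
  these pairs. Of the final 0-1 solution, the edges without a heavier conflicting neighbour form a
  matching of weight at least \<open>A - Q / 2\<close>.

  The colourings come from code words with few pairwise agreements. Without an input colouring, the
  same code words give Linial's colour reduction from the identifiers in \<open>log* n\<close> steps.\<close>

section \<open>Codes with few agreements\<close>

text \<open>Union bound over the sets \<open>P\<close> of \<open>k\<close> positions on which a bad
  word copies \<open>b\<close>: there are at most \<open>m ^ k\<close> of them, and each leaves
  \<open>m - k\<close> letters free.\<close>

lemma card_words_agreeing_le:
  fixes b :: "nat \<Rightarrow> nat"
  assumes "k \<le> m"
  shows "card {w \<in> {..<m} \<rightarrow>\<^sub>E {..<s}. k \<le> card {x. x < m \<and> w x = b x}} \<le> m ^ k * s ^ (m - k)"
proof -
  let ?W = "{..<m} \<rightarrow>\<^sub>E {..<s}"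
  let ?P = "{P. P \<subseteq> {..<m} \<and> card P = k}"
  let ?C = "\<lambda>P. PiE {..<m} (\<lambda>x. if x \<in> P then {b x} else {..<s})"
  have sub: "{w \<in> ?W. k \<le> card {x. x < m \<and> w x = b x}} \<subseteq> (\<Union>P\<in>?P. ?C P)"
  proof
    fix w assume w: "w \<in> {w \<in> ?W. k \<le> card {x. x < m \<and> w x = b x}}"
    then obtain P where P: "P \<subseteq> {x. x < m \<and> w x = b x}" "card P = k"
      by (auto elim: obtain_subset_with_card_n)
    have "w \<in> ?C P" using w P by (auto simp: PiE_iff)
    then show "w \<in> (\<Union>P\<in>?P. ?C P)" using P by blast
  qed
  have cC: "card (?C P) = s ^ (m - k)" if "P \<in> ?P" for P
  proof -
    have "card (?C P) = (\<Prod>x<m. card (if x \<in> P then {b x} else {..<s}))" by (simp add: card_PiE)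
    also have "\<dots> = (\<Prod>x<m. if x \<in> P then 1 else s)" by (rule prod.cong) auto
    also have "\<dots> = (\<Prod>x\<in>{..<m} - P. s)" by (simp add: prod.If_cases Diff_eq)
    also have "\<dots> = s ^ (m - k)" using that by (simp add: card_Diff_subset finite_subset[of P "{..<m}"])
    finally show ?thesis .
  qed
  have fin: "finite ?P" by simp
  have "card {w \<in> ?W. k \<le> card {x. x < m \<and> w x = b x}} \<le> card (\<Union>P\<in>?P. ?C P)"
    by (rule card_mono[OF _ sub]) (auto intro!: finite_PiE)
  also have "\<dots> \<le> (\<Sum>P\<in>?P. card (?C P))" by (rule card_UN_le[OF fin])
  also have "\<dots> = card ?P * s ^ (m - k)" using cC by simp
  also have "card ?P = m choose k" by (simp add: n_subsets)
  also have "(m choose k) * s ^ (m - k) \<le> m ^ k * s ^ (m - k)"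
    using binomial_le_pow[OF assms] by simp
  finally show ?thesis .
qed

text \<open>Over an alphabet of \<open>2 * m\<close> letters each \<open>b\<close> spoils at most a
  \<open>2 ^ -k\<close> share of all words, so fewer than \<open>2 ^ k\<close> of them cannot spoil
  everything.\<close>

lemma exists_distant_word:
  fixes B :: "(nat \<Rightarrow> nat) set"
  assumes B: "finite B" "card B < 2 ^ k" and m: "m > 0"
  shows "\<exists>w. (\<forall>x<m. w x < 2 * m) \<and> (\<forall>b\<in>B. card {x. x < m \<and> w x = b x} < k)"
proof (cases "k \<le> m")
  \<comment> \<open>With fewer than \<open>k\<close> positions no agreement can reach
    \<open>k\<close>, so any word serves.\<close>
  case False
  have "card {x. x < m \<and> (\<lambda>_. 0) x = b x} < k" for b :: "nat \<Rightarrow> nat"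
    using card_mono[of "{..<m}" "{x. x < m \<and> (\<lambda>_. 0) x = b x}"] False by fastforce
  then show ?thesis using m by (intro exI[of _ "\<lambda>_. 0"]) auto
next
  case True
  let ?W = "{..<m} \<rightarrow>\<^sub>E {..<2*m}"
  let ?bad = "\<lambda>b. {w \<in> ?W. k \<le> card {x. x < m \<and> w x = b x}}"
  have "card (\<Union>b\<in>B. ?bad b) \<le> (\<Sum>b\<in>B. card (?bad b))" by (rule card_UN_le[OF B(1)])
  also have "\<dots> \<le> (\<Sum>b\<in>B. m ^ k * (2*m) ^ (m - k))"
    by (rule sum_mono) (rule card_words_agreeing_le[OF True])
  also have "\<dots> = card B * (m ^ k * (2*m) ^ (m - k))" by simp
  also have "\<dots> < 2 ^ k * (m ^ k * (2*m) ^ (m - k))" using B m by simp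
  also have "\<dots> = (2*m) ^ k * (2*m) ^ (m - k)" by (simp add: power_mult_distrib)
  also have "\<dots> = (2*m) ^ m" using True by (metis le_add_diff_inverse power_add)
  also have "\<dots> = card ?W" by (simp add: card_PiE)
  finally have lt: "card (\<Union>b\<in>B. ?bad b) < card ?W" .
  have "\<not> ?W \<subseteq> (\<Union>b\<in>B. ?bad b)"
  proof
    assume "?W \<subseteq> (\<Union>b\<in>B. ?bad b)"
    then have "card ?W \<le> card (\<Union>b\<in>B. ?bad b)"
      using B(1) by (intro card_mono) (auto intro!: finite_PiE)
    with lt show False by simp
  qed
  then obtain w where w: "w \<in> ?W" "w \<notin> (\<Union>b\<in>B. ?bad b)" by blast
  show ?thesis
  proof (intro exI[of _ w] conjI ballI allI impI)
    fix x assume "x < m" then show "w x < 2*m" using w(1) by (auto simp: PiE_iff)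
  next
    fix b assume "b \<in> B" then show "card {x. x < m \<and> w x = b x} < k" using w by force
  qed
qed

text \<open>Distance from the constant words, the last conjunct, is needed to avoid neighbours whose colour
  is already fixed.\<close>
definition is_code :: "nat \<Rightarrow> nat \<Rightarrow> nat \<Rightarrow> (nat \<Rightarrow> nat \<Rightarrow> nat) \<Rightarrow> bool" where
  "is_code N m k F \<longleftrightarrow>
     (\<forall>c<N. \<forall>x<m. F c x < 2 * m) \<and>
     (\<forall>c<N. \<forall>c'<N. c \<noteq> c' \<longrightarrow> card {x. x < m \<and> F c x = F c' x} < k) \<and>
     (\<forall>c<N. \<forall>y<2*m. card {x. x < m \<and> F c x = y} < k)"

text \<open>Greedy choice in the style of Gilbert and Varshamov: a new word must avoid the at most
  \<open>N\<close> earlier words and the \<open>2 * m\<close> constant words.\<close>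

lemma exists_code:
  assumes "N + 2 * m < 2 ^ k" "m > 0"
  shows "\<exists>F. is_code N m k F"
  using assms(1)
proof (induction N)
  case 0
  then show ?case by (simp add: is_code_def)
next
  case (Suc N)
  then obtain F where F: "is_code N m k F" by auto
  let ?B = "F ` {..<N} \<union> (\<lambda>y _. y) ` {..<2*m}"
  have "card ?B \<le> card (F ` {..<N}) + card ((\<lambda>y _::nat. y) ` {..<2*m})" by (rule card_Un_le)
  also have "\<dots> \<le> N + 2*m"
    using card_image_le[of "{..<N}" F] card_image_le[of "{..<2*m}" "\<lambda>y _::nat. y"] by simp
  finally have "card ?B < 2 ^ k" using Suc.prems by simp
  from exists_distant_word[OF _ this assms(2)] obtain w where
    w: "\<forall>x<m. w x < 2 * m" "\<forall>b\<in>?B. card {x. x < m \<and> w x = b x} < k" by auto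
  have w1: "card {x. x < m \<and> w x = F c x} < k" if "c < N" for c using w(2) that by blast
  then have w2: "card {x. x < m \<and> F c x = w x} < k" if "c < N" for c
    using that by (simp add: eq_commute)
  have w3: "card {x. x < m \<and> w x = y} < k" if "y < 2*m" for y using w(2) that by force
  have "is_code (Suc N) m k (F(N := w))"
    using F w(1) w1 w2 w3 by (auto simp: is_code_def less_Suc_eq)
  then show ?case by blast
qed

section \<open>Fractional solutions by doubling\<close>

locale conflict_graph =
  fixes E :: "nat set" and nb :: "nat \<Rightarrow> nat set"
  assumes finite_E: "finite E"
    and nb_subset: "e \<in> E \<Longrightarrow> nb e \<subseteq> E"
    and nb_sym: "e \<in> E \<Longrightarrow> f \<in> nb e \<Longrightarrow> e \<in> nb f"
begin

lemma finite_nb: "e \<in> E \<Longrightarrow> finite (nb e)"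
  using finite_subset[OF nb_subset finite_E] .

text \<open>Double counting over ordered adjacent pairs; every argument that charges a conflict to
  one of its ends rests on it.\<close>

lemma sum_pairs_swap:
  "(\<Sum>e\<in>E. \<Sum>f\<in>nb e. g e f) = (\<Sum>e\<in>E. \<Sum>f\<in>nb e. (g f e :: real))"
proof -
  have nb: "nb e = {f \<in> E. f \<in> nb e}" "nb e = {f \<in> E. e \<in> nb f}" if "e \<in> E" for e
    using that nb_subset nb_sym by blast+
  have "(\<Sum>e\<in>E. \<Sum>f\<in>nb e. g e f) = (\<Sum>e\<in>E. \<Sum>f | f \<in> E \<and> f \<in> nb e. g e f)"
    by (rule sum.cong) (use nb(1) in auto)
  also have "\<dots> = (\<Sum>f\<in>E. \<Sum>e | e \<in> E \<and> f \<in> nb e. g e f)"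
    by (rule sum.swap_restrict[OF finite_E finite_E])
  also have "\<dots> = (\<Sum>f\<in>E. \<Sum>e\<in>nb f. g e f)"
    by (rule sum.cong) (use nb(2) in auto)
  finally show ?thesis .
qed

text \<open>The conflict \<open>Q\<close> is \<open>bil wmin x x\<close>; other weights single out
  the monochromatic pairs or the remaining ones.\<close>

definition bil :: "(nat \<Rightarrow> nat \<Rightarrow> real) \<Rightarrow> (nat \<Rightarrow> real) \<Rightarrow> (nat \<Rightarrow> real) \<Rightarrow> real" where
  "bil w u v = (\<Sum>e\<in>E. \<Sum>f\<in>nb e. w e f * u e * v f)"

lemma bil_sym:
  assumes "\<And>e f. w e f = w f e"
  shows "bil w u v = bil w v u"
  unfolding bil_def by (subst sum_pairs_swap) (simp add: assms mult_ac)

text \<open>Expansion of a quadratic form, used to price a step \<open>d\<close> of the doubling or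
  of the rounding.\<close>

lemma bil_add:
  assumes "\<And>e f. w e f = w f e"
  shows "bil w (\<lambda>e. u e + d e) (\<lambda>e. u e + d e) = bil w u u + 2 * bil w d u + bil w d d"
proof -
  have "bil w (\<lambda>e. u e + d e) (\<lambda>e. u e + d e) = bil w u u + bil w u d + bil w d u + bil w d d"
    unfolding bil_def by (simp add: algebra_simps sum.distrib)
  with bil_sym[where w = w and u = u and v = d, OF assms] show ?thesis by simp
qed

end

text \<open>The threshold \<open>1/4\<close> fits \<open>grow_conflict\<close>: a doubling by
  \<open>d e\<close> adds to \<open>Q\<close> at most three times \<open>d e\<close> times the load,
  thus at most \<open>3/4\<close> of the weight gained.\<close>

fun grow :: "(nat \<Rightarrow> nat set) \<Rightarrow> (nat \<Rightarrow> real) \<Rightarrow> nat \<Rightarrow> nat \<Rightarrow> nat \<Rightarrow> real" where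
  "grow nb a k 0 e = (1/2) ^ k"
| "grow nb a k (Suc t) e =
     (if a e * grow nb a k t e + (\<Sum>f\<in>nb e. a f * grow nb a k t f) < a e / 4
      then 2 * grow nb a k t e else grow nb a k t e)"

text \<open>An exponent drops by at most one per round, so within \<open>k\<close> rounds no value
  exceeds \<open>1\<close>. Negative powers of two are what the rounding can later double exactly to
  \<open>1\<close>.\<close>

lemma grow_dyadic:
  "t \<le> k \<Longrightarrow> \<exists>i. k - t \<le> i \<and> i \<le> k \<and> grow nb a k t e = (1/2) ^ i"
proof (induction t)
  case 0 then show ?case by auto
next
  case (Suc t)
  then obtain i where i: "k - t \<le> i" "i \<le> k" "grow nb a k t e = (1/2)^i" by auto
  obtain j where j: "i = Suc j" using i(1) Suc.prems by (cases i) auto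
  have "grow nb a k (Suc t) e = (1/2)^j \<or> grow nb a k (Suc t) e = (1/2)^i" using i j by simp
  moreover have "k - Suc t \<le> j" "j \<le> k" "k - Suc t \<le> i" using i j by auto
  ultimately show ?case using i(2) by blast
qed

lemma grow_pos: "grow nb a k t e > 0"
  by (induction t) auto

lemma grow_mono_Suc: "grow nb a k t e \<le> grow nb a k (Suc t) e"
  using grow_pos[of nb a k t e] by auto

locale weighted_conflict_graph = conflict_graph +
  fixes a :: "nat \<Rightarrow> real"
  assumes a_nonneg: "e \<in> E \<Longrightarrow> 0 \<le> a e"
begin

abbreviation wmin :: "nat \<Rightarrow> nat \<Rightarrow> real" where
  "wmin e f \<equiv> min (a e) (a f)"

definition gain :: "real \<Rightarrow> (nat \<Rightarrow> real) \<Rightarrow> real" where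
  "gain l x = (\<Sum>e\<in>E. a e * x e) - l * (\<Sum>e\<in>E. \<Sum>f\<in>nb e. wmin e f * x e * x f)"

abbreviation load :: "(nat \<Rightarrow> real) \<Rightarrow> nat \<Rightarrow> real" where
  "load x e \<equiv> a e * x e + (\<Sum>f\<in>nb e. a f * x f)"

lemma load_mono:
  assumes "e \<in> E" "\<And>f. x f \<le> y f"
  shows "load x e \<le> load y e"
  using assms a_nonneg nb_subset
  by (intro add_mono sum_mono mult_left_mono) blast+

text \<open>Loads never decrease, so an edge that stopped once stays satisfied; an edge that never
  stopped has doubled in every round.\<close>

lemma grow_load_doubling:
  assumes e: "e \<in> E"
  shows "a e / 4 \<le> load (grow nb a k t) e \<or> grow nb a k t e = (1/2) ^ k * 2 ^ t"
proof (induction t)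
  case 0 then show ?case by simp
next
  case (Suc t)
  show ?case
  proof (cases "load (grow nb a k t) e < a e / 4")
    case True
    then show ?thesis using Suc.IH by auto
  next
    case False
    have "load (grow nb a k t) e \<le> load (grow nb a k (Suc t)) e"
      using grow_mono_Suc by (rule load_mono[OF e])
    then show ?thesis using False by linarith
  qed
qed

lemma load_nonneg_part: "e \<in> E \<Longrightarrow> (\<And>f. 0 \<le> x f) \<Longrightarrow> 0 \<le> (\<Sum>f\<in>nb e. a f * x f)"
  using a_nonneg nb_subset by (intro sum_nonneg mult_nonneg_nonneg) blast+

text \<open>An edge that doubled in all \<open>k\<close> rounds has reached the value
  \<open>1\<close>, and its own term then supplies the load.\<close>

lemma grow_load:
  assumes e: "e \<in> E"
  shows "a e / 4 \<le> load (grow nb a k k) e"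
  using grow_load_doubling[OF e, of k k]
proof
  assume "grow nb a k k e = (1/2) ^ k * 2 ^ k"
  then have "grow nb a k k e = 1" by (simp flip: power_mult_distrib)
  moreover have "0 \<le> (\<Sum>f\<in>nb e. a f * grow nb a k k f)"
    using grow_pos less_imp_le by (intro load_nonneg_part[OF e]) blast
  ultimately show ?thesis using a_nonneg[OF e] by simp
qed

lemma wmin_nonneg: "e \<in> E \<Longrightarrow> f \<in> nb e \<Longrightarrow> 0 \<le> wmin e f"
  using a_nonneg nb_subset by (metis min_def subsetD)

text \<open>At the start each edge has at most \<open>2 ^ k / 2\<close> neighbours of value
  \<open>2 ^ -k\<close>, so \<open>Q\<close> is at most half the weight. Afterwards only doubling
  edges change anything, and their load is small at that moment.\<close>

lemma grow_conflict:
  assumes deg: "\<And>e. e \<in> E \<Longrightarrow> 2 * card (nb e) \<le> 2 ^ k"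
  shows "bil wmin (grow nb a k t) (grow nb a k t) \<le> 3/4 * (\<Sum>e\<in>E. a e * grow nb a k t e)"
proof (induction t)
  case 0
  have "bil wmin (grow nb a k 0) (grow nb a k 0) \<le> (\<Sum>e\<in>E. \<Sum>f\<in>nb e. a e * (1/2)^k * (1/2)^k)"
    unfolding bil_def by (intro sum_mono) (simp add: mult_right_mono)
  also have "\<dots> = (\<Sum>e\<in>E. a e * (1/2)^k * (card (nb e) * (1/2)^k))" by (simp add: mult_ac)
  also have "\<dots> \<le> (\<Sum>e\<in>E. a e * (1/2)^k * (1/2))"
  proof (intro sum_mono mult_left_mono)
    fix e assume e: "e \<in> E"
    have "real (2 * card (nb e)) \<le> 2 ^ k" using deg[OF e] by (metis of_nat_le_iff of_nat_numeral of_nat_power)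
    then show "real (card (nb e)) * (1/2)^k \<le> 1/2" by (simp add: power_one_over field_simps)
    show "0 \<le> a e * (1/2)^k" using a_nonneg[OF e] by simp
  qed
  also have "\<dots> \<le> 3/4 * (\<Sum>e\<in>E. a e * grow nb a k 0 e)"
    unfolding sum_distrib_left using a_nonneg by (intro sum_mono) (simp add: mult_left_mono)
  finally show ?case .
next
  case (Suc t)
  let ?x = "grow nb a k t"
  define d where "d e = (if load ?x e < a e / 4 then ?x e else 0)" for e
  have x': "grow nb a k (Suc t) = (\<lambda>e. ?x e + d e)" by (rule ext) (simp add: d_def)
  have d0: "0 \<le> d e" "d e \<le> ?x e" for e using grow_pos[of nb a k t e] by (auto simp: d_def)
  \<comment> \<open>Since \<open>d\<close> is at most the old value, the quadratic term is absorbed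
    by the mixed one, giving three mixed terms in total.\<close>
  have dd: "bil wmin d d \<le> bil wmin d ?x"
    unfolding bil_def using d0 wmin_nonneg by (intro sum_mono mult_left_mono mult_nonneg_nonneg)
  have dx: "bil wmin d ?x \<le> (\<Sum>e\<in>E. a e * d e / 4)"
    unfolding bil_def
  proof (rule sum_mono)
    fix e assume e: "e \<in> E"
    have "(\<Sum>f\<in>nb e. wmin e f * d e * ?x f) = d e * (\<Sum>f\<in>nb e. wmin e f * ?x f)"
      by (simp add: sum_distrib_left mult_ac)
    \<comment> \<open>Bounding the minimum by the weight of the neighbour turns the conflict into
      load, whichever end is heavier.\<close>
    also have "\<dots> \<le> d e * (\<Sum>f\<in>nb e. a f * ?x f)"
      using d0 less_imp_le[OF grow_pos] by (intro mult_left_mono sum_mono mult_right_mono) auto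
    also have "\<dots> \<le> d e * (a e / 4)"
    proof (cases "load ?x e < a e / 4")
      case True
      moreover have "0 \<le> a e * ?x e" using a_nonneg[OF e] grow_pos less_imp_le by (intro mult_nonneg_nonneg) blast+
      ultimately show ?thesis using d0 by (intro mult_left_mono) linarith+
    qed (simp add: d_def)
    finally show "(\<Sum>f\<in>nb e. wmin e f * d e * ?x f) \<le> a e * d e / 4" by (simp add: mult_ac)
  qed
  have "bil wmin (grow nb a k (Suc t)) (grow nb a k (Suc t)) \<le> bil wmin ?x ?x + 3 * bil wmin d ?x"
    unfolding x' using dd by (subst bil_add) (auto simp: min.commute)
  also have "\<dots> \<le> 3/4 * (\<Sum>e\<in>E. a e * ?x e) + 3 * (\<Sum>e\<in>E. a e * d e / 4)"
    using Suc.IH dx by linarith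
  also have "\<dots> = 3/4 * (\<Sum>e\<in>E. a e * grow nb a k (Suc t) e)"
    unfolding x' by (simp add: sum_distrib_left sum.distrib algebra_simps flip: sum_divide_distrib)
  finally show ?case .
qed

end

section \<open>Rounding by conditional expectations\<close>

text \<open>All edges of class \<open>s\<close> decide at once by conditional expectations:
  undecided edges enter with their value \<open>x\<close>, the mean of \<open>0\<close> and
  \<open>2 * x\<close>, and neighbours of the same class are ignored. The factor \<open>2\<close>
  counts each pair from both ends.\<close>

fun sweep :: "(nat \<Rightarrow> nat set) \<Rightarrow> (nat \<Rightarrow> real) \<Rightarrow> real \<Rightarrow> (nat \<Rightarrow> nat) \<Rightarrow> (nat \<Rightarrow> real) \<Rightarrow> nat \<Rightarrow> nat \<Rightarrow> real" where
  "sweep nb a l \<kappa> x 0 e = x e"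
| "sweep nb a l \<kappa> x (Suc s) e =
     (if \<kappa> e = s \<and> x e < 1
      then if 2 * l * (\<Sum>f\<in>nb e. if \<kappa> f = \<kappa> e then 0 else min (a e) (a f) * sweep nb a l \<kappa> x s f) \<le> a e
           then 2 * x e else 0
      else sweep nb a l \<kappa> x s e)"

lemma sweep_unchanged: "s \<le> \<kappa> e \<Longrightarrow> sweep nb a l \<kappa> x s e = x e"
  by (induction s) auto

lemma sweep_value:
  "\<kappa> e < s \<Longrightarrow> sweep nb a l \<kappa> x s e = 0 \<and> x e < 1 \<or> sweep nb a l \<kappa> x s e = 2 * x e \<and> x e < 1
     \<or> sweep nb a l \<kappa> x s e = x e \<and> 1 \<le> x e"
proof (induction s)
  case (Suc s)
  then show ?case
    by (cases "\<kappa> e = s") (auto simp: sweep_unchanged)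
qed simp

context weighted_conflict_graph
begin

definition wmono :: "(nat \<Rightarrow> nat) \<Rightarrow> nat \<Rightarrow> nat \<Rightarrow> real" where
  "wmono \<kappa> e f = (if \<kappa> f = \<kappa> e then wmin e f else 0)"

definition wprop :: "(nat \<Rightarrow> nat) \<Rightarrow> nat \<Rightarrow> nat \<Rightarrow> real" where
  "wprop \<kappa> e f = (if \<kappa> f = \<kappa> e then 0 else wmin e f)"

lemma bil_wmin_split: "bil wmin u v = bil (wprop \<kappa>) u v + bil (wmono \<kappa>) u v"
  unfolding bil_def sum.distrib[symmetric] wmono_def wprop_def
  by (intro sum.cong) auto

text \<open>No pair weighted by \<open>wprop\<close> lies inside a class, so the objective is affine
  in the values of class \<open>s\<close>. Its increment is the sum of \<open>d e * ?g e\<close>,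
  where \<open>d e\<close> is given the sign of \<open>?g e\<close>.\<close>

lemma sweep_step:
  assumes l: "0 \<le> l"
  defines "obj \<equiv> \<lambda>\<kappa> y. (\<Sum>e\<in>E. a e * y e) - l * bil (wprop \<kappa>) y y"
  assumes x0: "\<And>e. e \<in> E \<Longrightarrow> 0 \<le> x e"
  shows "obj \<kappa> (sweep nb a l \<kappa> x s) \<le> obj \<kappa> (sweep nb a l \<kappa> x (Suc s))"
proof -
  let ?y = "sweep nb a l \<kappa> x s"
  let ?g = "\<lambda>e. a e - 2 * l * (\<Sum>f\<in>nb e. wprop \<kappa> e f * ?y f)"
  have g: "?g e = a e - 2 * l * (\<Sum>f\<in>nb e. if \<kappa> f = \<kappa> e then 0 else wmin e f * ?y f)" for e
    unfolding wprop_def by (simp add: if_distrib[of "\<lambda>z. z * _"] cong: if_cong)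
  define d where "d e = (if \<kappa> e = s \<and> x e < 1 then if 0 \<le> ?g e then x e else - x e else 0)" for e
  have y': "sweep nb a l \<kappa> x (Suc s) = (\<lambda>e. ?y e + d e)"
    by (rule ext) (auto simp: d_def g sweep_unchanged)
  have sym: "wprop \<kappa> e f = wprop \<kappa> f e" for e f by (auto simp: wprop_def min.commute)
  have dd: "bil (wprop \<kappa>) d d = 0"
    unfolding bil_def by (intro sum.neutral ballI) (auto simp: wprop_def d_def)
  have "0 \<le> (\<Sum>e\<in>E. d e * ?g e)"
    using x0 by (intro sum_nonneg) (auto simp: d_def intro!: mult_nonneg_nonpos)
  also have "\<dots> = (\<Sum>e\<in>E. a e * d e) - 2 * l * bil (wprop \<kappa>) d ?y"
    unfolding bil_def sum_distrib_left sum_subtractf[symmetric]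
    by (intro sum.cong) (auto simp: algebra_simps sum_distrib_left)
  also have "\<dots> = obj \<kappa> (\<lambda>e. ?y e + d e) - obj \<kappa> ?y"
    unfolding obj_def bil_add[where w = "wprop \<kappa>", OF sym] dd by (simp add: algebra_simps sum.distrib)
  finally show ?thesis unfolding y' by simp
qed

lemma gain_bil: "gain l x = (\<Sum>e\<in>E. a e * x e) - l * bil wmin x x"
  by (simp add: gain_def bil_def)

text \<open>Doubling both ends quadruples a monochromatic conflict; this is the only loss.\<close>
lemma sweep_gain:
  assumes l: "0 \<le> l" "l \<le> 1" and x0: "\<And>e. e \<in> E \<Longrightarrow> 0 \<le> x e" and T: "\<And>e. e \<in> E \<Longrightarrow> \<kappa> e < T"
    and defect: "bil (wmono \<kappa>) x x \<le> \<delta> * bil wmin x x"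
  shows "gain (l + 3 * \<delta>) x \<le> gain l (sweep nb a l \<kappa> x T)"
proof -
  let ?y = "sweep nb a l \<kappa> x"
  have "(\<Sum>e\<in>E. a e * x e) - l * bil (wprop \<kappa>) x x
      \<le> (\<Sum>e\<in>E. a e * ?y s e) - l * bil (wprop \<kappa>) (?y s) (?y s)" for s
  proof (induction s)
    case 0
    have "sweep nb a l \<kappa> x 0 = x" by (rule ext) simp
    then show ?case by simp
  next
    case (Suc s)
    from order_trans[OF Suc sweep_step[OF l(1) x0]] show ?case .
  qed
  note proper_part = this[of T]
  have "bil (wmono \<kappa>) (?y T) (?y T) \<le> bil (wmono \<kappa>) (\<lambda>e. 2 * x e) (\<lambda>e. 2 * x e)"
    unfolding bil_def
  proof (intro sum_mono)
    fix e f assume e: "e \<in> E" and f: "f \<in> nb e"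
    then have fE: "f \<in> E" using nb_subset by blast
    have b: "0 \<le> ?y T g \<and> ?y T g \<le> 2 * x g" if "g \<in> E" for g
      using sweep_value[of \<kappa> g T nb a l x] T[OF that] x0[OF that] by auto
    show "wmono \<kappa> e f * ?y T e * ?y T f \<le> wmono \<kappa> e f * (2 * x e) * (2 * x f)"
      using b[OF e] b[OF fE] wmin_nonneg[OF e f] x0[OF e]
      by (intro mult_mono mult_nonneg_nonneg) (auto simp: wmono_def)
  qed
  also have "\<dots> = 4 * bil (wmono \<kappa>) x x"
    unfolding bil_def sum_distrib_left by (intro sum.cong) auto
  finally have mono: "bil (wmono \<kappa>) (?y T) (?y T) \<le> 4 * bil (wmono \<kappa>) x x" .
  have b0: "0 \<le> bil (wmono \<kappa>) x x"
    unfolding bil_def using x0 nb_subset wmin_nonneg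
    by (intro sum_nonneg mult_nonneg_nonneg) (auto simp: wmono_def)
  have "l * bil (wmono \<kappa>) (?y T) (?y T) \<le> l * (4 * bil (wmono \<kappa>) x x)"
    using mono l by (intro mult_left_mono)
  \<comment> \<open>Of the four copies of the monochromatic conflict one is already paid for in the
    gain of \<open>x\<close>; the other three become \<open>3 * \<delta>\<close>.\<close>
  moreover have "l * bil (wmono \<kappa>) x x \<le> \<delta> * bil wmin x x"
    using mult_right_mono[OF l(2) b0] defect by linarith
  ultimately show ?thesis
    unfolding gain_bil using proper_part bil_wmin_split[of x x \<kappa>] bil_wmin_split[of "?y T" "?y T" \<kappa>]
    by (simp add: algebra_simps)
qed

end

section \<open>Defective colourings\<close>

text \<open>The chosen position has to be part of the new colour, hence \<open>2 * m\<^sup>2\<close> colours.\<close>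
definition refine_pos :: "(nat \<Rightarrow> nat set) \<Rightarrow> (nat \<Rightarrow> nat \<Rightarrow> real) \<Rightarrow> (nat \<Rightarrow> nat \<Rightarrow> nat) \<Rightarrow> nat
    \<Rightarrow> (nat \<Rightarrow> nat) \<Rightarrow> nat \<Rightarrow> nat" where
  "refine_pos nb W F m c e = arg_min_on (\<lambda>i. \<Sum>f\<in>nb e. if F (c f) i = F (c e) i then W e f else 0) {..<m}"

definition refine :: "(nat \<Rightarrow> nat set) \<Rightarrow> (nat \<Rightarrow> nat \<Rightarrow> real) \<Rightarrow> (nat \<Rightarrow> nat \<Rightarrow> nat) \<Rightarrow> nat
    \<Rightarrow> (nat \<Rightarrow> nat) \<Rightarrow> nat \<Rightarrow> nat" where
  "refine nb W F m c e =
     refine_pos nb W F m c e * (2 * m) + F (c e) (refine_pos nb W F m c e)"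

text \<open>Locally iterative reduction to \<open>2 * m\<close> colours: at time \<open>t\<close> the tentative colour of \<open>e\<close> is the
  letter \<open>F (c e) t\<close>, and \<open>e\<close> keeps it once it clashes with little of its neighbourhood. A monochromatic
  pair is then paid for by the endpoint that settled last.\<close>
fun settle :: "(nat \<Rightarrow> nat set) \<Rightarrow> (nat \<Rightarrow> nat \<Rightarrow> real) \<Rightarrow> (nat \<Rightarrow> nat \<Rightarrow> nat) \<Rightarrow> nat \<Rightarrow> nat
    \<Rightarrow> (nat \<Rightarrow> nat) \<Rightarrow> nat \<Rightarrow> nat \<Rightarrow> nat option" where
  "settle nb W F m k c 0 e = None"
| "settle nb W F m k c (Suc t) e =
     (case settle nb W F m k c t e of Some y \<Rightarrow> Some y
      | None \<Rightarrow>
        if (\<Sum>f\<in>nb e. if c f \<noteq> c e \<and> (case settle nb W F m k c t f of Some y \<Rightarrow> y | None \<Rightarrow> F (c f) t) = F (c e) t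
              then W e f else 0) * m \<le> 2 * k * (\<Sum>f\<in>nb e. W e f)
        then Some (F (c e) t) else None)"

text \<open>For edges of the graph \<open>settle_complete\<close> ensures that \<open>the\<close>
  meets a value after \<open>m\<close> rounds.\<close>

definition settled :: "(nat \<Rightarrow> nat set) \<Rightarrow> (nat \<Rightarrow> nat \<Rightarrow> real) \<Rightarrow> (nat \<Rightarrow> nat \<Rightarrow> nat) \<Rightarrow> nat \<Rightarrow> nat
    \<Rightarrow> (nat \<Rightarrow> nat) \<Rightarrow> nat \<Rightarrow> nat" where
  "settled nb W F m k c e = the (settle nb W F m k c m e)"

lemma settle_persists: "settle nb W F m k c t e = Some y \<Longrightarrow> t \<le> s \<Longrightarrow> settle nb W F m k c s e = Some y"
proof (induction s)
  case (Suc s)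
  then show ?case by (cases "t = Suc s") (auto simp del: settle.simps simp: settle.simps(2)[of _ _ _ _ _ _ s])
qed simp

lemma sum_indicator_card:
  "(\<Sum>x<(m::nat). if P x then w else 0) = real (card {x. x < m \<and> P x}) * w"
  by (simp add: sum.If_cases lessThan_def Int_def)

context conflict_graph
begin

context
  fixes W :: "nat \<Rightarrow> nat \<Rightarrow> real" and F :: "nat \<Rightarrow> nat \<Rightarrow> nat" and N m k :: nat and c :: "nat \<Rightarrow> nat"
  assumes W_nonneg: "\<And>e f. e \<in> E \<Longrightarrow> f \<in> nb e \<Longrightarrow> 0 \<le> W e f"
    and code: "is_code N m k F" and m_pos: "0 < m" and c_less: "\<And>e. e \<in> E \<Longrightarrow> c e < N"
begin

section \<open>Refinement of a colouring in one round\<close>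

lemma refine_pos:
  "refine_pos nb W F m c e < m"
  "i < m \<Longrightarrow> (\<Sum>f\<in>nb e. if F (c f) (refine_pos nb W F m c e) = F (c e) (refine_pos nb W F m c e) then W e f else 0)
     \<le> (\<Sum>f\<in>nb e. if F (c f) i = F (c e) i then W e f else 0)"
  unfolding refine_pos_def
  using arg_min_if_finite(1)[of "{..<m}"] m_pos
  by (auto intro!: arg_min_least)

lemma refine_less: "e \<in> E \<Longrightarrow> refine nb W F m c e < 2 * m * m"
proof -
  assume e: "e \<in> E"
  have F: "F (c e) (refine_pos nb W F m c e) < 2 * m"
    using code c_less[OF e] refine_pos(1) by (auto simp: is_code_def)
  have "Suc (refine_pos nb W F m c e) * (2 * m) \<le> m * (2 * m)"
    using refine_pos(1)[of e] by (intro mult_right_mono) auto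
  then show ?thesis using F unfolding refine_def by simp
qed

text \<open>Averaging: each neighbour agrees with \<open>e\<close> in fewer than \<open>k\<close> of
  the \<open>m\<close> positions, so an average position, and hence the chosen one, leaves at most a
  \<open>k / m\<close> share of the neighbourhood in conflict.\<close>

lemma refine_conflict:
  assumes e: "e \<in> E" and proper: "\<And>f. f \<in> nb e \<Longrightarrow> c f \<noteq> c e"
  shows "m * (\<Sum>f\<in>nb e. if refine nb W F m c f = refine nb W F m c e then W e f else 0) \<le> k * (\<Sum>f\<in>nb e. W e f)"
proof -
  let ?p = "refine_pos nb W F m c"
  have F: "F (c g) (?p g) < 2 * m" if "g \<in> E" for g
    using code c_less[OF that] refine_pos(1) by (auto simp: is_code_def)
  have imp: "F (c f) (?p e) = F (c e) (?p e)"
    if f: "f \<in> nb e" and eq: "refine nb W F m c f = refine nb W F m c e" for f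
  proof -
    have fE: "f \<in> E" using f e nb_subset by blast
    \<comment> \<open>Letters are below \<open>2 * m\<close>, so quotient and remainder recover the
      position and the letter.\<close>
    from eq have "(?p f * (2*m) + F (c f) (?p f)) div (2*m) = (?p e * (2*m) + F (c e) (?p e)) div (2*m)"
      "(?p f * (2*m) + F (c f) (?p f)) mod (2*m) = (?p e * (2*m) + F (c e) (?p e)) mod (2*m)"
      by (simp_all add: refine_def)
    then have "?p f = ?p e" "F (c f) (?p f) = F (c e) (?p e)"
      using F[OF e] F[OF fE] m_pos by auto
    then show ?thesis by simp
  qed
  have "(\<Sum>f\<in>nb e. if refine nb W F m c f = refine nb W F m c e then W e f else 0)
     \<le> (\<Sum>f\<in>nb e. if F (c f) (?p e) = F (c e) (?p e) then W e f else 0)" (is "?L \<le> ?R")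
    using imp W_nonneg[OF e] by (intro sum_mono) auto
  then have "m * ?L \<le> (\<Sum>i<m. ?R)" by (simp add: mult_left_mono)
  also have "\<dots> \<le> (\<Sum>i<m. \<Sum>f\<in>nb e. if F (c f) i = F (c e) i then W e f else 0)"
    by (intro sum_mono refine_pos(2)) auto
  also have "\<dots> = (\<Sum>f\<in>nb e. \<Sum>i<m. if F (c f) i = F (c e) i then W e f else 0)"
    by (rule sum.swap)
  also have "\<dots> \<le> (\<Sum>f\<in>nb e. k * W e f)"
  proof (intro sum_mono)
    fix f assume f: "f \<in> nb e"
    have "card {x. x < m \<and> F (c f) x = F (c e) x} < k"
      using code c_less[OF e] c_less[of f] nb_subset[OF e] f proper[OF f] by (auto simp: is_code_def)
    then show "(\<Sum>i<m. if F (c f) i = F (c e) i then W e f else 0) \<le> k * W e f"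
      using W_nonneg[OF e f] unfolding sum_indicator_card by (intro mult_right_mono) auto
  qed
  finally show ?thesis by (simp add: sum_distrib_left)
qed

section \<open>Locally iterative colour reduction\<close>

abbreviation "stl \<equiv> settle nb W F m k c"
abbreviation tent :: "nat \<Rightarrow> nat \<Rightarrow> nat" where
  "tent t f \<equiv> (case stl t f of Some y \<Rightarrow> y | None \<Rightarrow> F (c f) t)"
text \<open>Neighbours of the same old colour share the whole code word; they are left out here and
  form the first term in \<open>settled_conflict\<close>.\<close>

abbreviation clash :: "nat \<Rightarrow> nat \<Rightarrow> real" where
  "clash t e \<equiv> (\<Sum>f\<in>nb e. if c f \<noteq> c e \<and> tent t f = F (c e) t then W e f else 0)"

lemma settle_time:
  "stl t e = Some y \<Longrightarrow> \<exists>s<t. stl s e = None \<and> stl (Suc s) e = Some y \<and> y = F (c e) s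
     \<and> clash s e * m \<le> 2 * k * (\<Sum>f\<in>nb e. W e f)"
proof (induction t)
  case (Suc t)
  show ?case
  proof (cases "stl t e")
    case None
    then show ?thesis using Suc.prems by (intro exI[of _ t]) (auto split: if_splits)
  next
    case (Some y')
    then show ?thesis using Suc by (auto intro: less_SucI)
  qed
qed simp

text \<open>Until \<open>f\<close> settles it follows its own code word, afterwards it is constant;
  a code word of another colour meets either of them at most \<open>k\<close> times.\<close>

lemma tent_agree:
  assumes e: "e \<in> E" and f: "f \<in> E" and ne: "c f \<noteq> c e"
  shows "card {t. t < m \<and> tent t f = F (c e) t} \<le> 2 * k"
proof -
  let ?A = "{t. t < m \<and> F (c f) t = F (c e) t}"
  let ?B = "{t. t < m \<and> F (c e) t = settled nb W F m k c f}"
  have A: "card ?A < k" using code c_less e f ne by (auto simp: is_code_def)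
  have sub: "{t. t < m \<and> tent t f = F (c e) t} \<subseteq> ?A \<union> ?B"
  proof
    fix t assume t: "t \<in> {t. t < m \<and> tent t f = F (c e) t}"
    show "t \<in> ?A \<union> ?B"
    proof (cases "stl t f")
      case (Some y)
      then have "stl m f = Some y" using t by (auto intro: settle_persists)
      then show ?thesis using Some t by (auto simp: settled_def)
    qed (use t in auto)
  qed
  have B: "card ?B \<le> k"
  proof (cases "settled nb W F m k c f < 2 * m")
    case True
    then show ?thesis using code c_less[OF e] by (auto simp: is_code_def intro: less_imp_le)
  next
    case False
    \<comment> \<open>The value of \<open>settled\<close> is unspecified if \<open>f\<close> never
      settles; outside the alphabet it matches no letter.\<close>
    have "F (c e) t < 2 * m" if "t < m" for t using code c_less[OF e] that by (auto simp: is_code_def)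
    then have "?B = {}" using False by (metis (mono_tags, lifting) Collect_empty_eq)
    then show ?thesis by (metis card.empty zero_le)
  qed
  have "card {t. t < m \<and> tent t f = F (c e) t} \<le> card (?A \<union> ?B)"
    by (rule card_mono[OF _ sub]) auto
  also have "\<dots> \<le> card ?A + card ?B" by (rule card_Un_le)
  finally show ?thesis using A B by simp
qed

text \<open>An edge unsettled for \<open>m\<close> rounds would clash above the threshold in each of
  them, but over all rounds each neighbour clashes at most \<open>2 * k\<close> times.\<close>

lemma settle_complete:
  assumes e: "e \<in> E"
  shows "stl m e \<noteq> None"
proof
  assume none: "stl m e = None"
  have none': "stl t e = None" if "t \<le> m" for t
    using settle_persists[of nb W F m k c t e _ m] none that by (cases "stl t e") auto
  have gt: "2 * k * (\<Sum>f\<in>nb e. W e f) < clash t e * m" if "t < m" for t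
    using none'[of "Suc t"] none'[of t] that by (auto split: if_splits)
  have "m * (2 * k * (\<Sum>f\<in>nb e. W e f)) = (\<Sum>t<m. 2 * k * (\<Sum>f\<in>nb e. W e f))" by simp
  also have "\<dots> < (\<Sum>t<m. clash t e * m)"
    using gt m_pos by (intro sum_strict_mono) auto
  also have "\<dots> = m * (\<Sum>f\<in>nb e. \<Sum>t<m. if c f \<noteq> c e \<and> tent t f = F (c e) t then W e f else 0)"
    by (subst sum.swap) (simp add: sum_distrib_left mult.commute)
  also have "\<dots> \<le> m * (\<Sum>f\<in>nb e. 2 * k * W e f)"
  proof (intro mult_left_mono sum_mono)
    fix f assume f: "f \<in> nb e"
    then have fE: "f \<in> E" using e nb_subset by blast
    show "(\<Sum>t<m. if c f \<noteq> c e \<and> tent t f = F (c e) t then W e f else 0) \<le> 2 * k * W e f"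
    proof (cases "c f = c e")
      case False
      have "real (card {t. t < m \<and> tent t f = F (c e) t}) \<le> real (2 * k)"
        using tent_agree[OF e fE False] by (rule of_nat_mono)
      then show ?thesis using False W_nonneg[OF e f]
        unfolding sum_indicator_card by (auto intro!: mult_right_mono)
    qed (use W_nonneg[OF e f] in auto)
  qed simp
  finally show False by (simp add: sum_distrib_left)
qed

lemma settled_less: "e \<in> E \<Longrightarrow> settled nb W F m k c e < 2 * m"
proof -
  assume e: "e \<in> E"
  obtain y where y: "stl m e = Some y" using settle_complete[OF e] by auto
  from settle_time[OF y] obtain s where "s < m" "y = F (c e) s" by auto
  then show ?thesis using y code c_less[OF e] by (auto simp: is_code_def settled_def)
qed

text \<open>Take a new monochromatic pair with distinct old colours. Its later settler already saw
  the final colour of the other end, so the pair lies in the clash it tolerated, a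
  \<open>2 * k / m\<close> share. Pairs are counted in both orders, hence the
  \<open>4\<close>.\<close>

lemma settled_conflict:
  assumes W_sym: "\<And>e f. W e f = W f e"
  shows "(\<Sum>e\<in>E. \<Sum>f\<in>nb e. if settled nb W F m k c f = settled nb W F m k c e then W e f else 0)
    \<le> (\<Sum>e\<in>E. \<Sum>f\<in>nb e. if c f = c e then W e f else 0) + 4 * k / m * (\<Sum>e\<in>E. \<Sum>f\<in>nb e. W e f)"
proof -
  let ?S = "settled nb W F m k c"
  define settles_at where "settles_at e s \<longleftrightarrow> s < m \<and> stl s e = None \<and> stl (Suc s) e = Some (?S e)
     \<and> ?S e = F (c e) s \<and> clash s e * m \<le> 2 * k * (\<Sum>f\<in>nb e. W e f)" for e s
  have "\<exists>s. settles_at e s" if "e \<in> E" for e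
  proof -
    have "stl m e = Some (?S e)" using settle_complete[OF that] by (auto simp: settled_def)
    from settle_time[OF this] show ?thesis unfolding settles_at_def by blast
  qed
  then have "\<forall>e\<in>E. \<exists>s. settles_at e s" by blast
  from bchoice[OF this] obtain \<tau> where "\<forall>e\<in>E. settles_at e (\<tau> e)" ..
  then have \<tau>: "\<tau> e < m" "stl (\<tau> e) e = None" "stl (Suc (\<tau> e)) e = Some (?S e)"
     "?S e = F (c e) (\<tau> e)" "clash (\<tau> e) e * m \<le> 2 * k * (\<Sum>f\<in>nb e. W e f)" if "e \<in> E" for e
    using that unfolding settles_at_def by blast+
  define D where "D e f = (if c f \<noteq> c e \<and> tent (\<tau> e) f = F (c e) (\<tau> e) then W e f else 0)" for e f
  have tent: "tent (\<tau> e) f = F (c e) (\<tau> e)" if "e \<in> E" "f \<in> E" "?S f = ?S e" "\<tau> f \<le> \<tau> e" for e f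
  proof (cases "\<tau> f = \<tau> e")
    \<comment> \<open>In a tie both ends are still undecided, and the tentative letter of
      \<open>f\<close> is the one it settles on.\<close>
    case True
    then show ?thesis using \<tau>(2,4)[OF that(1)] \<tau>(2,4)[OF that(2)] that(3) by simp
  next
    case False
    then have "stl (\<tau> e) f = Some (?S f)"
      using that(4) by (intro settle_persists[OF \<tau>(3)[OF that(2)]]) simp
    then show ?thesis using \<tau>(4)[OF that(1)] that(3) by simp
  qed
  have "(\<Sum>e\<in>E. \<Sum>f\<in>nb e. if ?S f = ?S e then W e f else 0)
    \<le> (\<Sum>e\<in>E. \<Sum>f\<in>nb e. (if c f = c e then W e f else 0) + (D e f + D f e))"
  proof (intro sum_mono)
    fix e f assume e: "e \<in> E" and f: "f \<in> nb e"
    then have fE: "f \<in> E" using nb_subset by blast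
    have W: "0 \<le> W e f" "W f e = W e f" using W_nonneg[OF e f] W_sym by auto
    have D0: "0 \<le> D e f" "0 \<le> D f e" using W by (auto simp: D_def)
    show "(if ?S f = ?S e then W e f else 0) \<le> (if c f = c e then W e f else 0) + (D e f + D f e)"
    proof (cases "?S f = ?S e \<and> c f \<noteq> c e")
      case True
      then have "D e f = W e f \<or> D f e = W e f"
        using tent[OF e fE] tent[OF fE e] W by (cases "\<tau> f \<le> \<tau> e") (auto simp: D_def)
      then show ?thesis using D0 True by auto
    qed (use D0 W in auto)
  qed
  also have "\<dots> = (\<Sum>e\<in>E. \<Sum>f\<in>nb e. if c f = c e then W e f else 0) + 2 * (\<Sum>e\<in>E. \<Sum>f\<in>nb e. D e f)"
    using sum_pairs_swap[of D] by (simp add: sum.distrib)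
  also have "(\<Sum>e\<in>E. \<Sum>f\<in>nb e. D e f) \<le> (\<Sum>e\<in>E. 2 * k / m * (\<Sum>f\<in>nb e. W e f))"
  proof (rule sum_mono)
    fix e assume "e \<in> E"
    from \<tau>(5)[OF this] have "(\<Sum>f\<in>nb e. D e f) * m \<le> 2 * k * (\<Sum>f\<in>nb e. W e f)" by (simp add: D_def)
    then show "(\<Sum>f\<in>nb e. D e f) \<le> 2 * k / m * (\<Sum>f\<in>nb e. W e f)" using m_pos by (simp add: field_simps)
  qed
  finally show ?thesis by (simp add: sum_distrib_left mult.assoc)
qed

end

end

section \<open>The matching algorithm on the line graph\<close>

definition conflict_weight :: "(nat \<Rightarrow> real) \<Rightarrow> (nat \<Rightarrow> real) \<Rightarrow> nat \<Rightarrow> nat \<Rightarrow> real" where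
  "conflict_weight a x e f = min (a e) (a f) * x e * x f"

text \<open>The first reduction shrinks the palette to \<open>2 * m1 * m1\<close> in a single round,
  which keeps the second code short. The second gets down to \<open>2 * m2\<close> classes, linear
  in its word length, as the sweep spends a round on each class.\<close>

definition schedule :: "(nat \<Rightarrow> nat set) \<Rightarrow> (nat \<Rightarrow> real) \<Rightarrow> (nat \<Rightarrow> nat \<Rightarrow> nat) \<Rightarrow> nat \<Rightarrow> (nat \<Rightarrow> nat \<Rightarrow> nat) \<Rightarrow> nat
    \<Rightarrow> nat \<Rightarrow> (nat \<Rightarrow> nat) \<Rightarrow> (nat \<Rightarrow> real) \<Rightarrow> nat \<Rightarrow> nat" where
  "schedule nb a F1 m1 F2 m2 k2 c x =
     settled nb (conflict_weight a x) F2 m2 k2 (refine nb (conflict_weight a x) F1 m1 c)"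

text \<open>The schedule is recomputed in every phase because the conflict weights depend on the
  current values.\<close>

fun rounding :: "(nat \<Rightarrow> nat set) \<Rightarrow> (nat \<Rightarrow> real) \<Rightarrow> nat \<Rightarrow> (nat \<Rightarrow> nat \<Rightarrow> nat) \<Rightarrow> nat \<Rightarrow> (nat \<Rightarrow> nat \<Rightarrow> nat) \<Rightarrow> nat
    \<Rightarrow> nat \<Rightarrow> (nat \<Rightarrow> nat) \<Rightarrow> nat \<Rightarrow> nat \<Rightarrow> real" where
  "rounding nb a k F1 m1 F2 m2 k2 c 0 = grow nb a k k"
| "rounding nb a k F1 m1 F2 m2 k2 c (Suc p) =
     sweep nb a (1 - real (Suc p) / (2 * k))
       (schedule nb a F1 m1 F2 m2 k2 c (rounding nb a k F1 m1 F2 m2 k2 c p))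
       (rounding nb a k F1 m1 F2 m2 k2 c p) (2 * m2)"

text \<open>Equal weights are separated by the proper colouring, so of two adjacent edges exactly
  one beats the other.\<close>

definition beats :: "(nat \<Rightarrow> real) \<Rightarrow> (nat \<Rightarrow> nat) \<Rightarrow> nat \<Rightarrow> nat \<Rightarrow> bool" where
  "beats a c f e \<longleftrightarrow> a e < a f \<or> a e = a f \<and> c e < c f"

text \<open>Absence of a winning neighbour is phrased as a vanishing sum so that
  \<open>local_sum\<close> applies to it.\<close>

definition select :: "(nat \<Rightarrow> nat set) \<Rightarrow> (nat \<Rightarrow> real) \<Rightarrow> (nat \<Rightarrow> nat) \<Rightarrow> (nat \<Rightarrow> real) \<Rightarrow> nat \<Rightarrow> bool" where
  "select nb a c x e \<longleftrightarrow>
     x e = 1 \<and> (\<Sum>f\<in>nb e. if x f = 1 \<and> beats a c f e then 1 else 0) = (0::real)"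

context weighted_conflict_graph
begin

text \<open>Each conflict is charged to the losing end, whose weight is the minimum of the two. A
  rejected edge of value \<open>1\<close> has a winning neighbour, and this single conflict already
  cancels its weight.\<close>

lemma select_gain:
  assumes proper: "\<And>e f. e \<in> E \<Longrightarrow> f \<in> nb e \<Longrightarrow> c f \<noteq> c e"
    and x01: "\<And>e. e \<in> E \<Longrightarrow> x e = 0 \<or> x e = 1"
  shows "gain (1/2) x \<le> (\<Sum>e | e \<in> E \<and> select nb a c x e. a e)"
proof -
  define L where "L e f = (if beats a c f e then conflict_weight a x e f else 0)" for e f
  have half: "bil wmin x x = 2 * (\<Sum>e\<in>E. \<Sum>f\<in>nb e. L e f)"
  proof -
    have "bil wmin x x = (\<Sum>e\<in>E. \<Sum>f\<in>nb e. L e f + L f e)"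
      unfolding bil_def
    proof (intro sum.cong refl)
      fix e f assume "e \<in> E" "f \<in> nb e"
      from proper[OF this] have "beats a c f e \<longleftrightarrow> \<not> beats a c e f" by (auto simp: beats_def)
      then show "wmin e f * x e * x f = L e f + L f e"
        by (auto simp: L_def conflict_weight_def min.commute)
    qed
    then show ?thesis using sum_pairs_swap[of L] by (simp add: sum.distrib)
  qed
  have "a e * x e - (\<Sum>f\<in>nb e. L e f) \<le> (if select nb a c x e then a e else 0)" if e: "e \<in> E" for e
  proof -
    have L0: "0 \<le> L e f" if "f \<in> nb e" for f
    proof -
      have "f \<in> E" using that nb_subset[OF e] by blast
      then show ?thesis using wmin_nonneg[OF e that] x01[OF e] x01[of f]
        by (auto simp: L_def conflict_weight_def)
    qed
    then have S0: "0 \<le> (\<Sum>f\<in>nb e. L e f)" by (rule sum_nonneg)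
    show ?thesis
    proof (cases "x e = 1 \<and> \<not> select nb a c x e")
      case True
      then have "(\<Sum>f\<in>nb e. if x f = 1 \<and> beats a c f e then 1 else 0) \<noteq> (0::real)"
        by (simp add: select_def)
      then obtain f where f: "f \<in> nb e" "x f = 1" "beats a c f e"
        by (rule sum.not_neutral_contains_not_neutral) (simp split: if_splits)
      have "a e = L e f" using f True by (auto simp: L_def conflict_weight_def beats_def)
      also have "\<dots> \<le> (\<Sum>f\<in>nb e. L e f)"
        using L0 f(1) finite_nb[OF e] by (intro member_le_sum) auto
      finally show ?thesis using True by simp
    next
      case False
      then show ?thesis using S0 x01[OF e] a_nonneg[OF e] by (auto simp: select_def)
    qed
  qed
  then have "(\<Sum>e\<in>E. a e * x e - (\<Sum>f\<in>nb e. L e f)) \<le> (\<Sum>e\<in>E. if select nb a c x e then a e else 0)"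
    by (rule sum_mono)
  also have "\<dots> = (\<Sum>e | e \<in> E \<and> select nb a c x e. a e)"
    using finite_E by (simp add: sum.inter_filter)
  finally show ?thesis unfolding gain_bil half by (simp add: sum_subtractf)
qed

lemma select_independent:
  assumes "e \<in> E" "f \<in> nb e" "c f \<noteq> c e" "select nb a c x e" "select nb a c x f"
  shows False
proof -
  have no: "\<not> beats a c g h" if "h \<in> E" "g \<in> nb h" "select nb a c x g" "select nb a c x h" for g h
  proof
    assume b: "beats a c g h"
    have "(\<Sum>f\<in>nb h. if x f = 1 \<and> beats a c f h then 1 else 0) = (0::real)"
      using that(4) by (simp add: select_def)
    then have "\<forall>f\<in>nb h. (if x f = 1 \<and> beats a c f h then 1 else 0) = (0::real)"
      by (subst (asm) sum_nonneg_eq_0_iff) (use finite_nb[OF that(1)] in auto)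
    then show False using that b by (auto simp: select_def)
  qed
  have "f \<in> E" "e \<in> nb f" using assms nb_subset nb_sym by blast+
  then have "\<not> beats a c f e" "\<not> beats a c e f" using no assms by blast+
  with assms(3) show False by (auto simp: beats_def)
qed

context
  fixes c :: "nat \<Rightarrow> nat" and q k m1 k1 m2 k2 :: nat and F1 F2 :: "nat \<Rightarrow> nat \<Rightarrow> nat"
  assumes c_less: "\<And>e. e \<in> E \<Longrightarrow> c e < q"
    and proper: "\<And>e f. e \<in> E \<Longrightarrow> f \<in> nb e \<Longrightarrow> c f \<noteq> c e"
    and k: "0 < k" "\<And>e. e \<in> E \<Longrightarrow> 2 * card (nb e) \<le> 2 ^ k"
    and code1: "is_code q m1 k1 F1" and m1: "0 < m1" "12 * k * k1 \<le> m1"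
    and code2: "is_code (2 * m1 * m1) m2 k2 F2" and m2: "0 < m2" "48 * k * k2 \<le> m2"
begin

text \<open>The second colouring inherits the monochromatic pairs of the first and adds its own. The
  factors \<open>12\<close> and \<open>48\<close> make the shares \<open>k1 / m1\<close> and
  \<open>4 * k2 / m2\<close> at most \<open>1 / (12 * k)\<close> each.\<close>

lemma schedule_defect:
  assumes x0: "\<And>e. e \<in> E \<Longrightarrow> 0 \<le> x e"
  defines "\<kappa> \<equiv> schedule nb a F1 m1 F2 m2 k2 c x"
  shows "bil (wmono \<kappa>) x x \<le> 1 / (6 * k) * bil wmin x x"
    and "e \<in> E \<Longrightarrow> \<kappa> e < 2 * m2"
proof -
  let ?W = "conflict_weight a x"
  let ?c = "refine nb ?W F1 m1 c"
  have W0: "0 \<le> ?W e f" if "e \<in> E" "f \<in> nb e" for e f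
    using that wmin_nonneg[OF that] x0 nb_subset[OF that(1)] unfolding conflict_weight_def by fastforce
  have Wsym: "?W e f = ?W f e" for e f by (simp add: conflict_weight_def min.commute)
  have c1: "?c e < 2 * m1 * m1" if "e \<in> E" for e
    by (rule refine_less[where W = ?W, OF _ code1 m1(1) c_less that]) (rule W0)
  have Q: "(\<Sum>e\<in>E. \<Sum>f\<in>nb e. ?W e f) = bil wmin x x"
    by (simp add: bil_def conflict_weight_def)
  have Q0: "0 \<le> bil wmin x x" unfolding Q[symmetric] using W0 by (intro sum_nonneg) auto
  have mono: "(\<Sum>e\<in>E. \<Sum>f\<in>nb e. if \<kappa> f = \<kappa> e then ?W e f else 0) = bil (wmono \<kappa>) x x" for \<kappa>
    unfolding bil_def wmono_def conflict_weight_def by (intro sum.cong) auto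
  have "(\<Sum>e\<in>E. \<Sum>f\<in>nb e. if ?c f = ?c e then ?W e f else 0) \<le> (\<Sum>e\<in>E. k1 / m1 * (\<Sum>f\<in>nb e. ?W e f))"
  proof (rule sum_mono)
    fix e assume e: "e \<in> E"
    have "m1 * (\<Sum>f\<in>nb e. if ?c f = ?c e then ?W e f else 0) \<le> k1 * (\<Sum>f\<in>nb e. ?W e f)"
      by (rule refine_conflict[where W = ?W and c = c, OF _ code1 m1(1) c_less e proper[OF e]]) (auto intro: W0)
    then show "(\<Sum>f\<in>nb e. if ?c f = ?c e then ?W e f else 0) \<le> k1 / m1 * (\<Sum>f\<in>nb e. ?W e f)"
      using m1(1) by (simp add: field_simps)
  qed
  also have "\<dots> = k1 / m1 * bil wmin x x" unfolding Q[symmetric] by (simp add: sum_distrib_left)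
  finally have 1: "(\<Sum>e\<in>E. \<Sum>f\<in>nb e. if ?c f = ?c e then ?W e f else 0) \<le> k1 / m1 * bil wmin x x" .
  have 2: "bil (wmono \<kappa>) x x
    \<le> (\<Sum>e\<in>E. \<Sum>f\<in>nb e. if ?c f = ?c e then ?W e f else 0) + 4 * k2 / m2 * bil wmin x x"
    unfolding mono[symmetric] Q[symmetric] \<kappa>_def schedule_def
    by (rule settled_conflict[where W = ?W, OF _ code2 m2(1) c1]) (auto intro: W0 Wsym)
  have "real (12 * k * k1) \<le> real m1" "real (48 * k * k2) \<le> real m2" using m1(2) m2(2) of_nat_mono by blast+
  then have r: "k1 / m1 \<le> 1 / (12 * k)" "4 * k2 / m2 \<le> 1 / (12 * k)"
    using m1(1) m2(1) k(1) by (simp_all add: field_simps)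
  from mult_right_mono[OF r(1) Q0] mult_right_mono[OF r(2) Q0]
  show "bil (wmono \<kappa>) x x \<le> 1 / (6 * k) * bil wmin x x"
    using 1 2 by (simp add: field_simps)
  show "\<kappa> e < 2 * m2" if "e \<in> E"
    unfolding \<kappa>_def schedule_def
    by (rule settled_less[where W = ?W, OF _ code2 m2(1) c1 that]) (auto intro: W0)
qed

abbreviation "rnd \<equiv> rounding nb a k F1 m1 F2 m2 k2 c"

text \<open>A phase doubles or drops every value below \<open>1\<close>, so after \<open>k\<close>
  phases only \<open>0\<close> and \<open>1\<close> remain.\<close>

lemma rounding_dyadic:
  "p \<le> k \<Longrightarrow> e \<in> E \<Longrightarrow> rnd p e = 0 \<or> (\<exists>i\<le>k - p. rnd p e = (1/2) ^ i)"
proof (induction p arbitrary: e)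
  case 0
  show ?case using grow_dyadic[of k k nb a e] by auto
next
  case (Suc p)
  have pos: "0 \<le> rnd p g" if "g \<in> E" for g using Suc.IH[OF _ that] Suc.prems(1) by auto
  let ?\<kappa> = "schedule nb a F1 m1 F2 m2 k2 c (rnd p)"
  have "?\<kappa> e < 2 * m2"
    using schedule_defect(2)[of "rnd p" e] pos Suc.prems(2) by blast
  from sweep_value[where \<kappa> = ?\<kappa> and e = e, OF this]
  have v: "rnd (Suc p) e = 0 \<or> rnd (Suc p) e = 2 * rnd p e \<and> rnd p e < 1 \<or> rnd (Suc p) e = rnd p e \<and> 1 \<le> rnd p e"
    by auto
  consider "rnd p e = 0" | i where "i \<le> k - p" "rnd p e = (1/2)^i"
    using Suc.IH[OF _ Suc.prems(2)] Suc.prems(1) by (meson Suc_leD)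
  then show ?case
  proof cases
    case 1
    then show ?thesis using v by auto
  next
    case (2 i)
    show ?thesis
    proof (cases i)
      case 0
      then show ?thesis using 2 v by auto
    next
      case (Suc j)
      have "(1/2::real) ^ Suc j < 1" by (rule power_Suc_less_one) auto
      moreover have "2 * rnd p e = (1/2)^j" using 2 Suc by simp
      moreover have "j \<le> k - Suc p" using 2 Suc by simp
      ultimately show ?thesis using v 2(2) Suc by auto
    qed
  qed
qed

lemma rounding_nonneg: "p \<le> k \<Longrightarrow> e \<in> E \<Longrightarrow> 0 \<le> rnd p e"
  using rounding_dyadic[of p e] by auto

lemma rounding_gain:
  "p \<le> k \<Longrightarrow> gain 1 (grow nb a k k) \<le> gain (1 - real p / (2 * k)) (rnd p)"
proof (induction p)
  case 0
  then show ?case by simp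
next
  case (Suc p)
  let ?l = "1 - real (Suc p) / (2 * k)"
  have pos: "0 \<le> rnd p g" if "g \<in> E" for g using rounding_nonneg[OF _ that] Suc.prems by simp
  \<comment> \<open>The loss of a phase, three times the defect \<open>1 / (6 * k)\<close>, is
    exactly one step of the coefficient.\<close>
  have eq: "?l + 3 * (1 / (6 * k)) = 1 - real p / (2 * k)" using k(1) by (simp add: field_simps)
  have "gain (?l + 3 * (1 / (6 * k))) (rnd p) \<le> gain ?l (rnd (Suc p))"
    using Suc.prems k(1) schedule_defect[OF pos] pos
    by (simp only: rounding.simps) (rule sweep_gain; (simp add: field_simps)?)
  then show ?case unfolding eq using Suc.IH Suc.prems by (meson Suc_leD order_trans)
qed

text \<open>The conflict is at most \<open>3/4\<close> of the weight, so the gain starts at a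
  quarter of the weight; the phases end at coefficient \<open>1/2\<close>, the one that
  \<open>select_gain\<close> handles.\<close>

lemma select_weight:
  "(\<Sum>e\<in>E. a e * grow nb a k k e) \<le> 4 * (\<Sum>e | e \<in> E \<and> select nb a c (rnd k) e. a e)"
proof -
  have "(\<Sum>e\<in>E. a e * grow nb a k k e) / 4 \<le> gain 1 (grow nb a k k)"
    using grow_conflict[OF k(2), of k] by (simp add: gain_bil)
  also have "\<dots> \<le> gain (1/2) (rnd k)" using rounding_gain[of k] k(1) by simp
  also have "\<dots> \<le> (\<Sum>e | e \<in> E \<and> select nb a c (rnd k) e. a e)"
  proof (rule select_gain[OF proper])
    show "rnd k e = 0 \<or> rnd k e = 1" if "e \<in> E" for e
      using rounding_dyadic[OF order_refl that] by simp
  qed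
  finally show ?thesis by simp
qed

end

end

section \<open>Locality\<close>

text \<open>One record per instance makes a distributed quantity a function of the network and an
  edge.\<close>

record network =
  verts :: "nat set"
  edges :: "nat set"
  incid :: "nat \<Rightarrow> nat set"
  node_id :: "nat + nat \<Rightarrow> nat"
  node_col :: "nat + nat \<Rightarrow> nat option"
  wt :: "nat \<Rightarrow> real"

definition networks :: "network set" where
  "networks = {I. hypergraph (verts I) (edges I) (incid I) \<and> inj_on (node_id I) (inc_nodes (verts I) (edges I))}"

definition line_nbrs :: "network \<Rightarrow> nat \<Rightarrow> nat set" where
  "line_nbrs I e = {f \<in> edges I. f \<noteq> e \<and> incid I e \<inter> incid I f \<noteq> {}}"

definition nview :: "network \<Rightarrow> nat \<Rightarrow> nat + nat \<Rightarrow> lview" where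
  "nview I = view (local_input (node_id I) (node_col I) (wt I)) (inc_nbrs (verts I) (edges I) (incid I))"

text \<open>One round on the line graph costs two rounds on the incidence graph.\<close>
definition local_fun :: "nat \<Rightarrow> (network \<Rightarrow> nat \<Rightarrow> 'b) \<Rightarrow> bool" where
  "local_fun t \<phi> \<longleftrightarrow> (\<exists>dec. \<forall>I\<in>networks. \<forall>e\<in>edges I. \<phi> I e = dec (nview I (2 * t) (Inr e)))"

fun cut :: "nat \<Rightarrow> lview \<Rightarrow> lview" where
  "cut 0 (LV i M) = LV i {#}"
| "cut (Suc t) (LV i M) = LV i (image_mset (cut t) M)"

fun children :: "lview \<Rightarrow> lview set" where
  "children (LV i M) = set_mset M"

fun root :: "lview \<Rightarrow> ninput" where
  "root (LV i M) = i"

fun input_id :: "ninput \<Rightarrow> nat" where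
  "input_id (VtxIn i c) = i"
| "input_id (EdgIn i c w) = i"

text \<open>A deeper view determines all shallower ones; this lets a node run an algorithm of
  smaller radius.\<close>

lemma cut_view: "s \<le> t \<Longrightarrow> cut s (view inp nb t x) = view inp nb s x"
proof (induction s arbitrary: t x)
  case 0
  then show ?case by (cases t) auto
next
  case (Suc s)
  then obtain t' where "t = Suc t'" "s \<le> t'" by (cases t) auto
  then show ?case using Suc.IH by (simp add: multiset.map_comp comp_def)
qed

lemma root_view: "root (view inp nb t x) = inp x"
  by (cases t) auto

lemma children_view: "finite (nb x) \<Longrightarrow> children (view inp nb (Suc t) x) = view inp nb t ` nb x"
  by simp

lemma input_id_local_input: "input_id (local_input i c a x) = i x"
  by (cases x) (auto simp: local_input_def)

lemma local_weight: "local_fun 0 wt"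
  unfolding local_fun_def nview_def
  by (intro exI[of _ "\<lambda>u. case root u of EdgIn i c w \<Rightarrow> w"]) (simp add: root_view local_input_def)

lemma local_color: "local_fun 0 (\<lambda>I e. node_col I (Inr e))"
  unfolding local_fun_def nview_def
  by (intro exI[of _ "\<lambda>u. case root u of EdgIn i c w \<Rightarrow> c"]) (simp add: root_view local_input_def)

lemma local_id: "local_fun 0 (\<lambda>I e. node_id I (Inr e))"
  unfolding local_fun_def nview_def
  by (intro exI[of _ "\<lambda>u. input_id (root u)"]) (simp add: root_view local_input_def)

lemma local_mono:
  assumes "local_fun s \<phi>" "s \<le> t"
  shows "local_fun t \<phi>"
proof -
  obtain dec where dec: "\<forall>I\<in>networks. \<forall>e\<in>edges I. \<phi> I e = dec (nview I (2 * s) (Inr e))"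
    using assms(1) unfolding local_fun_def by blast
  show ?thesis unfolding local_fun_def
    using dec assms(2) by (intro exI[of _ "\<lambda>u. dec (cut (2 * s) u)"]) (simp add: nview_def cut_view)
qed

lemma local_map: "local_fun t \<phi> \<Longrightarrow> local_fun t (\<lambda>I e. g (\<phi> I e))"
proof -
  assume "local_fun t \<phi>"
  then obtain dec where dec: "\<forall>I\<in>networks. \<forall>e\<in>edges I. \<phi> I e = dec (nview I (2 * t) (Inr e))"
    unfolding local_fun_def by blast
  then show ?thesis unfolding local_fun_def by (intro exI[of _ "\<lambda>u. g (dec u)"]) simp
qed

lemma local_pair:
  assumes "local_fun t \<phi>" "local_fun t \<psi>"
  shows "local_fun t (\<lambda>I e. (\<phi> I e, \<psi> I e))"
proof -
  obtain dec where dec: "\<forall>I\<in>networks. \<forall>e\<in>edges I. \<phi> I e = dec (nview I (2 * t) (Inr e))"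
    using assms(1) unfolding local_fun_def by blast
  obtain dec' where dec': "\<forall>I\<in>networks. \<forall>e\<in>edges I. \<psi> I e = dec' (nview I (2 * t) (Inr e))"
    using assms(2) unfolding local_fun_def by blast
  show ?thesis unfolding local_fun_def using dec dec' by (intro exI[of _ "\<lambda>u. (dec u, dec' u)"]) simp
qed

text \<open>Lets an edge hold a whole table of values, such as the cost of every position in
  \<open>refine\<close>.\<close>

lemma local_ext:
  assumes "\<And>i. local_fun t (\<lambda>I e. \<phi> I e i)"
  shows "local_fun t \<phi>"
proof -
  have "\<forall>i. \<exists>dec. \<forall>I\<in>networks. \<forall>e\<in>edges I. \<phi> I e i = dec (nview I (2 * t) (Inr e))"
    using assms unfolding local_fun_def by blast
  from choice[OF this] obtain dec where
    "\<forall>i. \<forall>I\<in>networks. \<forall>e\<in>edges I. \<phi> I e i = dec i (nview I (2 * t) (Inr e))" ..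
  then show ?thesis unfolding local_fun_def by (intro exI[of _ "\<lambda>u i. dec i u"]) auto
qed

text \<open>A neighbouring edge may be reached through several common vertices; unique identifiers
  let an edge count it only once, and skip itself.\<close>
lemma local_sum:
  fixes g :: "'b \<Rightarrow> 'b \<Rightarrow> real"
  assumes "local_fun t \<phi>"
  shows "local_fun (Suc t) (\<lambda>I e. \<Sum>f\<in>line_nbrs I e. g (\<phi> I e) (\<phi> I f))"
proof -
  obtain dec where dec: "\<And>I e. I \<in> networks \<Longrightarrow> e \<in> edges I \<Longrightarrow> \<phi> I e = dec (nview I (2 * t) (Inr e))"
    using assms unfolding local_fun_def by blast
  \<comment> \<open>Two levels below an edge node sit the edges sharing a vertex with it; a set
    merges repeated copies, and the identifier test filters out the edge itself. These subviews have
    depth \<open>2 * t\<close>, so the own view is cut to the same depth.\<close>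
  define nviews where "nviews u = {u'. input_id (root u') \<noteq> input_id (root u) \<and> (\<exists>v\<in>children u. u' \<in> children v)}" for u
  have "(\<Sum>f\<in>line_nbrs I e. g (\<phi> I e) (\<phi> I f))
      = (\<Sum>u'\<in>nviews u. g (dec (cut (2 * t) u)) (dec u'))"
    if I: "I \<in> networks" and e: "e \<in> edges I" and u: "u = nview I (2 * Suc t) (Inr e)" for I e u
  proof -
    have H: "finite (verts I)" "finite (edges I)" "\<And>e. e \<in> edges I \<Longrightarrow> incid I e \<subseteq> verts I"
      and inj: "inj_on (node_id I) (inc_nodes (verts I) (edges I))"
      using I by (auto simp: networks_def hypergraph_def)
    let ?nb = "inc_nbrs (verts I) (edges I) (incid I)"
    have nbe: "?nb (Inr e) = Inl ` incid I e"
      using H(3)[OF e] e by (auto simp: inc_nbrs_def inc_nodes_def inc_adj_def)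
    have nbv: "?nb (Inl v) = Inr ` {f \<in> edges I. v \<in> incid I f}" if "v \<in> verts I" for v
      using that by (auto simp: inc_nbrs_def inc_nodes_def inc_adj_def)
    have rt: "input_id (root (nview I s x)) = node_id I x" for s x
      by (simp add: nview_def root_view input_id_local_input)
    have ids: "node_id I (Inr f) = node_id I (Inr f') \<longleftrightarrow> f = f'" if "f \<in> edges I" "f' \<in> edges I" for f f'
      using inj that by (auto simp: inj_on_def inc_nodes_def)
    have fin: "finite (?nb x)" for x using H by (auto simp: inc_nbrs_def inc_nodes_def)
    have ch: "children (nview I (Suc s) x) = nview I s ` ?nb x" for s x
      unfolding nview_def by (rule children_view[OF fin])
    have chu: "children u = nview I (Suc (2 * t)) ` Inl ` incid I e"
      unfolding u using ch[of "Suc (2*t)"] nbe by simp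
    have "(\<exists>w\<in>children u. u' \<in> children w) \<longleftrightarrow>
        (\<exists>f\<in>edges I. incid I e \<inter> incid I f \<noteq> {} \<and> u' = nview I (2 * t) (Inr f))" for u'
    proof -
      have "(\<exists>w\<in>children u. u' \<in> children w) \<longleftrightarrow> (\<exists>v\<in>incid I e. u' \<in> nview I (2 * t) ` ?nb (Inl v))"
        unfolding chu by (simp add: ch)
      also have "\<dots> \<longleftrightarrow> (\<exists>v\<in>incid I e. \<exists>f\<in>edges I. v \<in> incid I f \<and> u' = nview I (2 * t) (Inr f))"
      proof (intro bex_cong refl)
        fix v assume "v \<in> incid I e"
        then have v: "v \<in> verts I" using H(3)[OF e] by blast
        show "u' \<in> nview I (2 * t) ` ?nb (Inl v) \<longleftrightarrow>
            (\<exists>f\<in>edges I. v \<in> incid I f \<and> u' = nview I (2 * t) (Inr f))"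
          unfolding nbv[OF v] by auto
      qed
      finally show ?thesis by blast
    qed
    then have nv: "nviews u = (\<lambda>f. nview I (2 * t) (Inr f)) ` line_nbrs I e"
      unfolding nviews_def line_nbrs_def using ids e rt by (auto simp: u)
    have inj': "inj_on (\<lambda>f. nview I (2 * t) (Inr f)) (line_nbrs I e)"
    proof (rule inj_onI)
      fix f f' assume "f \<in> line_nbrs I e" "f' \<in> line_nbrs I e" "nview I (2 * t) (Inr f) = nview I (2 * t) (Inr f')"
      then show "f = f'" using rt[of "2 * t" "Inr f"] rt[of "2 * t" "Inr f'"] ids[of f f']
        by (auto simp: line_nbrs_def)
    qed
    have "\<phi> I e = dec (cut (2 * t) u)" using dec[OF I e] unfolding u nview_def by (subst cut_view) auto
    moreover have "\<phi> I f = dec (nview I (2 * t) (Inr f))" if "f \<in> line_nbrs I e" for f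
      using dec[OF I] that by (auto simp: line_nbrs_def)
    ultimately show ?thesis unfolding nv sum.reindex[OF inj'] by simp
  qed
  then show ?thesis unfolding local_fun_def
    by (intro exI[of _ "\<lambda>u. \<Sum>u'\<in>nviews u. g (dec (cut (2 * t) u)) (dec u')"]) blast
qed

lemma local_map2:
  assumes "local_fun t \<phi>" "local_fun t \<psi>"
  shows "local_fun t (\<lambda>I e. g (\<phi> I e) (\<psi> I e))"
  using local_map[OF local_pair[OF assms], of "\<lambda>(x, y). g x y"] by simp

section \<open>Locality of the stages of the algorithm\<close>

lemma local_grow: "local_fun t (\<lambda>I. grow (line_nbrs I) (wt I) k t)"
proof (induction t)
  case 0
  show ?case unfolding local_fun_def by (intro exI[of _ "\<lambda>_. (1/2) ^ k"]) auto
next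
  case (Suc t)
  have P: "local_fun t (\<lambda>I e. (wt I e, grow (line_nbrs I) (wt I) k t e))"
    by (intro local_pair Suc.IH local_mono[OF local_weight]) simp
  have S: "local_fun (Suc t) (\<lambda>I e. \<Sum>f\<in>line_nbrs I e. wt I f * grow (line_nbrs I) (wt I) k t f)"
    using local_sum[OF P, of "\<lambda>_ (a, x). a * x"] by simp
  show ?case
    using local_map2[OF local_mono[OF P] S, of "\<lambda>(a, x) s. if a * x + s < a / 4 then 2 * x else x"]
    by (simp cong: if_cong)
qed

lemma local_sweep:
  assumes "local_fun s \<kappa>" "local_fun s x"
  shows "local_fun (s + t) (\<lambda>I. sweep (line_nbrs I) (wt I) l (\<kappa> I) (x I) t)"
proof (induction t)
  case 0
  then show ?case using assms(2) by simp
next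
  case (Suc t)
  have P: "local_fun (s + t) (\<lambda>I e. (wt I e, \<kappa> I e, x I e, sweep (line_nbrs I) (wt I) l (\<kappa> I) (x I) t e))"
    by (intro local_pair Suc.IH local_mono[OF local_weight] local_mono[OF assms(1)] local_mono[OF assms(2)]) auto
  have S: "local_fun (Suc (s + t)) (\<lambda>I e. \<Sum>f\<in>line_nbrs I e.
      if \<kappa> I f = \<kappa> I e then 0 else min (wt I e) (wt I f) * sweep (line_nbrs I) (wt I) l (\<kappa> I) (x I) t f)"
    using local_sum[OF P, of "\<lambda>(a, i, x, y) (a', i', x', y'). if i' = i then 0 else min a a' * y'"] by simp
  show ?case
    using local_map2[OF local_mono[OF P] S, where g = "\<lambda>(a, i, x, y) S. if i = t \<and> x < 1 then if 2 * l * S \<le> a then 2 * x else 0 else y"]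
    by (simp cong: if_cong)
qed

text \<open>The weight of a pair has to be computable from local data of its two ends, hence the
  form \<open>g (\<psi> I e) (\<psi> I f)\<close>.\<close>

lemma local_refine:
  assumes c: "local_fun s c" and \<psi>: "local_fun s \<psi>"
  shows "local_fun (Suc s) (\<lambda>I. refine (line_nbrs I) (\<lambda>e f. g (\<psi> I e) (\<psi> I f)) F m (c I))"
proof -
  have "local_fun (Suc s) (\<lambda>I e i. \<Sum>f\<in>line_nbrs I e. if F (c I f) i = F (c I e) i then g (\<psi> I e) (\<psi> I f) else 0)"
  proof (rule local_ext)
    fix i
    show "local_fun (Suc s) (\<lambda>I e. \<Sum>f\<in>line_nbrs I e. if F (c I f) i = F (c I e) i then g (\<psi> I e) (\<psi> I f) else 0)"
      using local_sum[OF local_pair[OF c \<psi>], of "\<lambda>(x, y) (x', y'). if F x' i = F x i then g y y' else 0"] by simp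
  qed
  from local_map2[OF local_mono[OF c] this, where g = "\<lambda>c S. arg_min_on S {..<m} * (2 * m) + F c (arg_min_on S {..<m})"]
  show ?thesis by (simp add: refine_def[abs_def] refine_pos_def)
qed

lemma local_settle:
  assumes c: "local_fun s c" and \<psi>: "local_fun s \<psi>"
  shows "local_fun (s + t) (\<lambda>I. settle (line_nbrs I) (\<lambda>e f. g (\<psi> I e) (\<psi> I f)) F m k (c I) t)"
proof (induction t)
  case 0
  show ?case unfolding local_fun_def by (intro exI[of _ "\<lambda>_. None"]) auto
next
  case (Suc t)
  let ?st = "\<lambda>I. settle (line_nbrs I) (\<lambda>e f. g (\<psi> I e) (\<psi> I f)) F m k (c I) t"
  have P: "local_fun (s + t) (\<lambda>I e. (c I e, \<psi> I e, ?st I e))"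
    by (intro local_pair Suc.IH local_mono[OF c] local_mono[OF \<psi>]) auto
  have S1: "local_fun (Suc (s + t)) (\<lambda>I e. \<Sum>f\<in>line_nbrs I e.
      if c I f \<noteq> c I e \<and> (case ?st I f of Some y \<Rightarrow> y | None \<Rightarrow> F (c I f) t) = F (c I e) t
      then g (\<psi> I e) (\<psi> I f) else 0)"
    using local_sum[OF P, of "\<lambda>(c, y, o1) (c', y', o2).
      if c' \<noteq> c \<and> (case o2 of Some y \<Rightarrow> y | None \<Rightarrow> F c' t) = F c t then g y y' else 0"] by simp
  have S2: "local_fun (Suc (s + t)) (\<lambda>I e. \<Sum>f\<in>line_nbrs I e. g (\<psi> I e) (\<psi> I f))"
    by (rule local_sum[OF local_mono[OF \<psi>]]) simp
  show ?case
    using local_map2[OF local_mono[OF P] local_pair[OF S1 S2], where g = "\<lambda>(c, y, o1) (S1, S2). case o1 of Some y \<Rightarrow> Some y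
           | None \<Rightarrow> if S1 * m \<le> 2 * k * S2 then Some (F c t) else None"]
    by (simp cong: if_cong option.case_cong)
qed

lemma local_schedule:
  assumes c: "local_fun s c" and x: "local_fun s x"
  shows "local_fun (Suc s + m2) (\<lambda>I. schedule (line_nbrs I) (wt I) F1 m1 F2 m2 k2 (c I) (x I))"
proof -
  let ?\<psi> = "\<lambda>I e. (wt I e, x I e)" and ?g = "\<lambda>(a, x) (a', x'). min a a' * x * (x' :: real)"
  have W: "conflict_weight (wt I) (x I) = (\<lambda>e f. ?g (?\<psi> I e) (?\<psi> I f))" for I
    by (intro ext) (simp add: conflict_weight_def)
  have \<psi>: "local_fun s ?\<psi>" by (intro local_pair x local_mono[OF local_weight]) simp
  have "local_fun (Suc s + m2) (\<lambda>I. settle (line_nbrs I) (\<lambda>e f. ?g (?\<psi> I e) (?\<psi> I f)) F2 m2 k2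
      (refine (line_nbrs I) (\<lambda>e f. ?g (?\<psi> I e) (?\<psi> I f)) F1 m1 (c I)) m2)"
    by (rule local_settle[OF local_refine[OF c \<psi>] local_mono[OF \<psi>]]) simp
  from local_map[OF this, of the] show ?thesis
    unfolding schedule_def settled_def[abs_def] W by simp
qed

text \<open>A phase costs one round for \<open>refine\<close>, \<open>m2\<close> for
  \<open>settle\<close> and \<open>2 * m2\<close> for the classes of the sweep; the term
  \<open>k\<close> is the doubling stage.\<close>

lemma local_rounding:
  assumes c: "local_fun s c"
  shows "local_fun (s + k + p * (1 + 3 * m2)) (\<lambda>I. rounding (line_nbrs I) (wt I) k F1 m1 F2 m2 k2 (c I) p)"
proof (induction p)
  case 0
  show ?case by (simp, rule local_mono[OF local_grow]) simp
next
  case (Suc p)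
  let ?s = "s + k + p * (1 + 3 * m2)"
  have c': "local_fun ?s c" by (rule local_mono[OF c]) simp
  have "local_fun (Suc ?s + m2 + 2 * m2) (\<lambda>I. rounding (line_nbrs I) (wt I) k F1 m1 F2 m2 k2 (c I) (Suc p))"
    unfolding rounding.simps
    by (rule local_sweep[OF local_schedule[OF c' Suc.IH] local_mono[OF Suc.IH]]) simp
  then show ?case by (simp add: algebra_simps)
qed

lemma local_select:
  assumes c: "local_fun s c" and x: "local_fun s x"
  shows "local_fun (Suc s) (\<lambda>I. select (line_nbrs I) (wt I) (c I) (x I))"
proof -
  have P: "local_fun s (\<lambda>I e. (wt I e, c I e, x I e))"
    by (intro local_pair c x local_mono[OF local_weight]) simp
  have S: "local_fun (Suc s) (\<lambda>I e. \<Sum>f\<in>line_nbrs I e. if x I f = 1 \<and> beats (wt I) (c I) f e then 1 else 0 :: real)"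
    using local_sum[OF P, of "\<lambda>(a, c, x) (a', c', x'). if x' = 1 \<and> (a < a' \<or> a = a' \<and> c < c') then 1 else 0"]
    by (simp add: beats_def)
  show ?thesis
    using local_map2[OF local_mono[OF x] S, where g = "\<lambda>x S. x = 1 \<and> S = 0"]
    by (simp add: select_def[abs_def])
qed

section \<open>Parameters and round complexity\<close>

definition lg :: "nat \<Rightarrow> nat" where
  "lg n = nat \<lceil>log 2 (real n + 1)\<rceil>"

lemma le_power_lg: "n \<le> 2 ^ lg n"
proof -
  have "log 2 (real n + 1) \<le> real (lg n)" unfolding lg_def by linarith
  then have "real n + 1 \<le> 2 powr real (lg n)" by (subst (asm) log_le_iff) auto
  then have "real n + 1 \<le> real (2 ^ lg n)" by (simp add: powr_realpow)
  then show ?thesis by linarith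
qed

lemma lg_le: "real (lg n) \<le> log 2 (real n + 1) + 1"
proof -
  have "0 \<le> log 2 (real n + 1)" by simp
  then show ?thesis unfolding lg_def by linarith
qed

text \<open>Word lengths are multiples of the distance parameter \<open>k\<close> itself, so the
  condition of \<open>exists_code\<close> takes the circular form \<open>N + c * k < 2 ^ k\<close>.
  Twice a logarithm solves it.\<close>

definition code_dist :: "nat \<Rightarrow> nat \<Rightarrow> nat" where
  "code_dist N c = 2 * lg (N + c) + 4"

lemma code_dist: "N + c * code_dist N c < 2 ^ code_dist N c"
proof -
  let ?l = "lg (N + c)"
  have 1: "2 * l + 5 < 2 ^ (l + 4)" for l :: nat
  proof (induction l)
    case (Suc l)
    have "(2::nat) ^ (Suc l + 4) = 2 * 2 ^ (l + 4)" by (simp only: add_Suc power_Suc)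
    then show ?case using Suc by simp
  qed simp
  have "N + c * code_dist N c \<le> (N + c) * (2 * ?l + 5)"
    unfolding code_dist_def by (simp add: algebra_simps)
  also have "\<dots> \<le> 2 ^ ?l * (2 * ?l + 5)" using le_power_lg by (rule mult_right_mono) simp
  also have "\<dots> < 2 ^ ?l * 2 ^ (?l + 4)" using 1 by simp
  also have "\<dots> = 2 ^ code_dist N c" unfolding code_dist_def by (simp flip: power_add)
  finally show ?thesis .
qed

lemma code_dist_le: "real (code_dist N c) \<le> 2 * log 2 (real N + real c + 1) + 6"
  using lg_le[of "N + c"] unfolding code_dist_def by simp

text \<open>The line graph has degree at most \<open>r * \<Delta>\<close>, so \<open>2 ^ k\<close>
  dominates twice the degree; the added \<open>1\<close> keeps \<open>k\<close> positive when
  \<open>\<Delta> = 0\<close>.\<close>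

definition growth_rounds :: "nat \<Rightarrow> nat \<Rightarrow> nat" where
  "growth_rounds r \<Delta> = lg (2 * r * \<Delta>) + 1"

text \<open>Here \<open>24\<close>, and \<open>96\<close> in \<open>dist2\<close>, are twice the
  factors \<open>12\<close> and \<open>48\<close> of the lengths, as \<open>exists_code\<close>
  counts the \<open>2 * m\<close> constant words.\<close>

definition dist1 :: "nat \<Rightarrow> nat \<Rightarrow> nat \<Rightarrow> nat" where
  "dist1 r \<Delta> q = code_dist q (24 * growth_rounds r \<Delta>)"

definition len1 :: "nat \<Rightarrow> nat \<Rightarrow> nat \<Rightarrow> nat" where
  "len1 r \<Delta> q = 12 * growth_rounds r \<Delta> * dist1 r \<Delta> q"

definition dist2 :: "nat \<Rightarrow> nat \<Rightarrow> nat \<Rightarrow> nat" where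
  "dist2 r \<Delta> q = code_dist (2 * len1 r \<Delta> q * len1 r \<Delta> q) (96 * growth_rounds r \<Delta>)"

definition len2 :: "nat \<Rightarrow> nat \<Rightarrow> nat \<Rightarrow> nat" where
  "len2 r \<Delta> q = 48 * growth_rounds r \<Delta> * dist2 r \<Delta> q"

definition line_rounds :: "nat \<Rightarrow> nat \<Rightarrow> nat \<Rightarrow> nat" where
  "line_rounds r \<Delta> q = growth_rounds r \<Delta> + growth_rounds r \<Delta> * (1 + 3 * len2 r \<Delta> q) + 1"

section \<open>Logarithm estimates and the round bound\<close>

abbreviation log_rank_deg :: "nat \<Rightarrow> nat \<Rightarrow> real" where
  "log_rank_deg r \<Delta> \<equiv> log 2 (real r) + log 2 (real \<Delta> + 2)"

lemma log2_le_minus_one: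
  assumes "2 \<le> x"
  shows "log 2 x \<le> x - 1"
proof -
  have "1 \<le> ln (2 ^ 2 :: real)" using exp_le by (subst ln_ge_iff) auto
  then have ln2: "1 / 2 \<le> ln (2 :: real)" by (subst (asm) ln_realpow) auto
  have "ln x = ln (x / 2) + ln 2" using assms by (simp add: ln_div)
  moreover have "ln (x / 2) \<le> x / 2 - 1" using assms by (intro ln_le_minus_one) simp
  \<comment> \<open>The right-hand side is a rewriting of \<open>x / 2 - 1 + ln 2\<close> whose
    subtracted product is nonnegative.\<close>
  ultimately have "ln x \<le> (x - 1) * ln 2 - (x - 2) * (ln 2 - 1 / 2)" by (simp add: field_simps)
  also have "\<dots> \<le> (x - 1) * ln 2" using assms ln2 by simp
  finally show ?thesis by (simp add: log_def divide_le_eq)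
qed

lemma log2_le_self:
  assumes "0 < x"
  shows "log 2 x \<le> x"
proof (cases "2 \<le> x")
  case False
  show ?thesis
  proof (cases "1 \<le> x")
    case True
    have "log 2 x \<le> 1" using False assms by simp
    then show ?thesis using True by linarith
  next
    case False
    then have "log 2 x \<le> 0" using assms by simp
    then show ?thesis using assms by linarith
  qed
qed (use log2_le_minus_one[of x] in simp)

lemma log_rank_deg_ge:
  assumes "2 \<le> r"
  shows "2 \<le> log_rank_deg r \<Delta>"
proof -
  have "log 2 2 \<le> log 2 (real r)" using assms by (subst log_le_cancel_iff) auto
  moreover have "log 2 2 \<le> log 2 (real \<Delta> + 2)" by (subst log_le_cancel_iff) auto
  moreover have "log 2 2 = (1::real)" by simp
  ultimately show ?thesis by linarith
qed

lemma log_le_log_rank_deg: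
  assumes "2 \<le> r" "0 < x" "x \<le> real r * (real \<Delta> + 2)"
  shows "log 2 x \<le> log_rank_deg r \<Delta>"
proof -
  have "log 2 x \<le> log 2 (real r * (real \<Delta> + 2))" using assms by (subst log_le_cancel_iff) auto
  also have "\<dots> = log_rank_deg r \<Delta>" using assms by (subst log_mult) auto
  finally show ?thesis .
qed

lemma growth_rounds_le:
  assumes "2 \<le> r"
  shows "real (growth_rounds r \<Delta>) \<le> 3 * log_rank_deg r \<Delta>"
proof -
  have le: "(real (2 * r * \<Delta>) + 1) / 2 \<le> real r * (real \<Delta> + 2)"
    using assms by (simp add: field_simps)
  have "log 2 (real (2 * r * \<Delta>) + 1) = log 2 (2 * ((real (2 * r * \<Delta>) + 1) / 2))" by (simp only: nonzero_mult_div_cancel_left times_divide_eq_right)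
  also have "\<dots> = 1 + log 2 ((real (2 * r * \<Delta>) + 1) / 2)"
    by (subst log_mult_pos) (auto intro: add_nonneg_pos)
  also have "\<dots> \<le> 1 + log_rank_deg r \<Delta>"
    using log_le_log_rank_deg[OF assms _ le] by (simp add: add_nonneg_pos)
  finally show ?thesis
    using lg_le[of "2 * r * \<Delta>"] log_rank_deg_ge[OF assms, of \<Delta>] unfolding growth_rounds_def by simp
qed

text \<open>The square of \<open>log r\<close> has to disappear in \<open>r * log \<Delta>\<close>;
  the estimate \<open>log r \<le> 2 * sqrt r\<close> does this.\<close>

lemma log_rank_deg_sq:
  assumes "2 \<le> r"
  shows "(log_rank_deg r \<Delta>)\<^sup>2 \<le> 8 * base_term \<Delta> r"
proof -
  let ?R = "log 2 (real r)" and ?L = "log 2 (real \<Delta> + 2)"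
  have L1: "1 \<le> ?L" by (subst le_log_iff) auto
  have R0: "0 \<le> ?R" using assms by simp
  have "?R = log 2 (sqrt r * sqrt r)" by simp
  also have "\<dots> = 2 * log 2 (sqrt r)" using assms by (subst log_mult) auto
  also have "\<dots> \<le> 2 * sqrt r" using log2_le_self[of "sqrt r"] assms by simp
  finally have "?R\<^sup>2 \<le> (2 * sqrt r)\<^sup>2" using R0 by (rule power_mono)
  also have "\<dots> = 4 * real r" by (simp add: power_mult_distrib)
  also have "\<dots> \<le> 4 * (real r * ?L)" using L1 assms by simp
  finally have 1: "?R\<^sup>2 \<le> 4 * (real r * ?L)" .
  have "0 \<le> (?R - ?L)\<^sup>2" by simp
  then have "(?R + ?L)\<^sup>2 \<le> 2 * ?R\<^sup>2 + 2 * ?L\<^sup>2" by (simp add: power2_sum power2_diff)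
  moreover have "0 \<le> ?L\<^sup>2" by simp
  moreover have "s \<le> 8 * (x + y)" if "s \<le> 2 * u + 2 * y" "0 \<le> y" "u \<le> 4 * x" for s u x y :: real
    using that by argo
  ultimately show ?thesis using 1 unfolding base_term_def by blast
qed

text \<open>With \<open>\<Lambda>\<close> for \<open>log_rank_deg\<close>, the number of phases and
  the first distance are \<open>O(\<Lambda>)\<close>. The intermediate palette is then polynomial in
  \<open>\<Lambda>\<close> and the second distance only \<open>O(log \<Lambda>)\<close>, so all
  phases together take \<open>O(\<Lambda>^2 * log \<Lambda>)\<close> rounds.\<close>

lemma line_rounds_le:
  assumes d: "0 \<le> (d::real)"
  shows "\<exists>K>0. \<forall>r \<Delta> q. 2 \<le> r \<and> log 2 (real q + 1) \<le> d * log_rank_deg r \<Delta> \<longrightarrow>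
           real (line_rounds r \<Delta> q) \<le> K * (base_term \<Delta> r * log 2 (base_term \<Delta> r + 2))"
proof -
  \<comment> \<open>These bound the first distance by \<open>C1 * \<Lambda>\<close>, the argument of
    the second logarithm by \<open>C2 * \<Lambda>^4\<close> and the second distance by
    \<open>C3 * (1 + log 2 \<Lambda>)\<close>.\<close>
  define C1 C2 C3 where "C1 = 2 * d + 22" and "C2 = 2 * (36 * C1)\<^sup>2 + 289" and "C3 = 2 * log 2 C2 + 14"
  have C2: "1 \<le> C2" unfolding C2_def by simp
  then have C3: "1 \<le> C3" unfolding C3_def by (simp add: add_nonneg_nonneg)
  show ?thesis
  \<comment> \<open>\<open>147\<close> is \<open>2 + 144 + 1\<close> from
    \<open>line_rounds\<close>, \<open>9\<close> the square of the \<open>3\<close> in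
    \<open>growth_rounds_le\<close>, \<open>8\<close> comes from \<open>log_rank_deg_sq\<close>, and
    \<open>5\<close> from comparing \<open>1 + log 2 \<Lambda>\<close> with
    \<open>log 2 (base_term \<Delta> r + 2)\<close>.\<close>
  proof (intro exI[of _ "147 * 9 * 8 * 5 * C3"] conjI allI impI)
    show "0 < 147 * 9 * 8 * 5 * C3" using C3 by simp
    fix r \<Delta> q :: nat
    assume "2 \<le> r \<and> log 2 (real q + 1) \<le> d * log_rank_deg r \<Delta>"
    then have r: "2 \<le> r" and q: "log 2 (real q + 1) \<le> d * log_rank_deg r \<Delta>" by auto
    define \<Lambda> where "\<Lambda> = log_rank_deg r \<Delta>"
    have \<Lambda>: "2 \<le> \<Lambda>" unfolding \<Lambda>_def by (rule log_rank_deg_ge[OF r])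
    let ?k = "real (growth_rounds r \<Delta>)"
    let ?k1 = "real (dist1 r \<Delta> q)" and ?m1 = "real (len1 r \<Delta> q)" and ?k2 = "real (dist2 r \<Delta> q)"
    have k: "?k \<le> 3 * \<Lambda>" unfolding \<Lambda>_def by (rule growth_rounds_le[OF r])
    have k1': "1 \<le> ?k" by (simp add: growth_rounds_def)
    have "log 2 (real q + 24 * ?k + 1) \<le> log 2 ((real q + 1) * (32 * ?k))"
    proof (subst log_le_cancel_iff)
      have "real q * 1 \<le> real q * (32 * ?k)" using k1' by (intro mult_left_mono) auto
      then show "real q + 24 * ?k + 1 \<le> (real q + 1) * (32 * ?k)" using k1' by (simp add: algebra_simps)
    qed (use k1' in auto)
    also have "\<dots> = log 2 (real q + 1) + (log 2 (2 ^ 5) + log 2 ?k)" using k1' by (simp add: log_mult)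
    also have "log 2 ((2::real) ^ 5) = 5" by (subst log_nat_power) auto
    also have "log 2 ?k \<le> ?k" using k1' by (intro log2_le_self) simp
    finally have "?k1 \<le> 2 * (d * \<Lambda> + 5 + 3 * \<Lambda>) + 6"
      using code_dist_le[of q "24 * growth_rounds r \<Delta>"] q k unfolding dist1_def \<Lambda>_def by simp
    also have "\<dots> \<le> C1 * \<Lambda>" using \<Lambda> by (simp add: C1_def algebra_simps)
    finally have k1: "?k1 \<le> C1 * \<Lambda>" .
    have C1: "0 \<le> C1" using d by (simp add: C1_def)
    have "?m1 \<le> 12 * (3 * \<Lambda>) * (C1 * \<Lambda>)"
      unfolding len1_def using k k1 \<Lambda> by (simp add: mult_mono)
    then have m1: "?m1 \<le> 36 * C1 * \<Lambda>\<^sup>2" by (simp add: power2_eq_square mult_ac)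
    have "?m1\<^sup>2 \<le> (36 * C1 * \<Lambda>\<^sup>2)\<^sup>2" using m1 by (rule power_mono) simp
    then have "2 * ?m1\<^sup>2 + 96 * ?k + 1 \<le> 2 * (36 * C1)\<^sup>2 * \<Lambda>^4 + 288 * \<Lambda> + 1"
      using k by (simp add: power_mult_distrib)
    also have "\<dots> \<le> 2 * (36 * C1)\<^sup>2 * \<Lambda>^4 + 288 * \<Lambda>^4 + 1 * \<Lambda>^4"
      using \<Lambda> self_le_power[of \<Lambda> 4] one_le_power[of \<Lambda> 4] by (intro add_mono) auto
    also have "\<dots> = C2 * \<Lambda>^4" by (simp add: C2_def algebra_simps)
    finally have in2: "2 * ?m1\<^sup>2 + 96 * ?k + 1 \<le> C2 * \<Lambda>^4" .
    have "log 2 (2 * ?m1\<^sup>2 + 96 * ?k + 1) \<le> log 2 (C2 * \<Lambda>^4)"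
      using in2 by (subst log_le_cancel_iff) (auto intro: add_nonneg_pos, use C2 \<Lambda> in auto)
    also have "\<dots> = log 2 C2 + 4 * log 2 \<Lambda>" using C2 \<Lambda> by (subst log_mult) (auto simp: log_nat_power)
    finally have "?k2 \<le> 2 * (log 2 C2 + 4 * log 2 \<Lambda>) + 6"
      using code_dist_le[of "2 * len1 r \<Delta> q * len1 r \<Delta> q" "96 * growth_rounds r \<Delta>"]
      unfolding dist2_def by (simp add: power2_eq_square mult.assoc)
    also have "\<dots> \<le> C3 * (1 + log 2 \<Lambda>)"
    proof -
      have "0 \<le> log 2 \<Lambda>" "0 \<le> log 2 C2" using \<Lambda> C2 by auto
      then have "0 \<le> log 2 C2 * log 2 \<Lambda>" "0 \<le> log 2 \<Lambda>" by auto
      then show ?thesis unfolding C3_def by (simp add: algebra_simps)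
    qed
    finally have k2: "?k2 \<le> C3 * (1 + log 2 \<Lambda>)" .
    have k21: "1 \<le> ?k2" by (simp add: dist2_def code_dist_def)
    have kk: "1 \<le> ?k\<^sup>2 * ?k2" "?k \<le> ?k\<^sup>2 * ?k2"
    proof -
      have "1 * 1 \<le> ?k\<^sup>2 * ?k2" using k1' k21 by (intro mult_mono) auto
      then show "1 \<le> ?k\<^sup>2 * ?k2" by simp
      have "?k * 1 \<le> ?k\<^sup>2 * ?k2" using k1' k21 by (intro mult_mono) (auto intro: self_le_power)
      then show "?k \<le> ?k\<^sup>2 * ?k2" by simp
    qed
    have "real (line_rounds r \<Delta> q) = 2 * ?k + 144 * (?k\<^sup>2 * ?k2) + 1"
      by (simp add: line_rounds_def len2_def algebra_simps power2_eq_square)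
    also have "\<dots> \<le> 147 * (?k\<^sup>2 * ?k2)" using kk by linarith
    also have "\<dots> \<le> 147 * ((3 * \<Lambda>)\<^sup>2 * (C3 * (1 + log 2 \<Lambda>)))"
      using k k2 k1' \<Lambda> by (intro mult_left_mono mult_mono power_mono) auto
    also have "\<dots> = 147 * 9 * C3 * (\<Lambda>\<^sup>2 * (1 + log 2 \<Lambda>))" by (simp add: power_mult_distrib)
    also have "\<dots> \<le> 147 * 9 * C3 * (8 * base_term \<Delta> r * (5 * log 2 (base_term \<Delta> r + 2)))"
    proof -
      have sq: "\<Lambda>\<^sup>2 \<le> 8 * base_term \<Delta> r" unfolding \<Lambda>_def by (rule log_rank_deg_sq[OF r])
      have "\<Lambda> \<le> \<Lambda>\<^sup>2" using \<Lambda> by (intro self_le_power) auto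
      also note sq
      finally have b: "\<Lambda> \<le> 8 * base_term \<Delta> r" .
      then have b0: "0 < base_term \<Delta> r" using \<Lambda> by simp
      have "log 2 \<Lambda> \<le> log 2 (2 ^ 3 * (base_term \<Delta> r + 2))"
        using b b0 \<Lambda> by (subst log_le_cancel_iff) auto
      also have "\<dots> = 3 + log 2 (base_term \<Delta> r + 2)"
        using b0 log_nat_power[of 2 2 3] by (subst log_mult_pos) auto
      finally have "1 + log 2 \<Lambda> \<le> 4 + log 2 (base_term \<Delta> r + 2)" by simp
      moreover have "1 \<le> log 2 (base_term \<Delta> r + 2)" using b0 by (subst le_log_iff) auto
      ultimately have "1 + log 2 \<Lambda> \<le> 5 * log 2 (base_term \<Delta> r + 2)" by simp
      then show ?thesis using sq C3 \<Lambda> b0 by (intro mult_left_mono mult_mono) auto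
    qed
    finally show "real (line_rounds r \<Delta> q) \<le> 147 * 9 * 8 * 5 * C3 * (base_term \<Delta> r * log 2 (base_term \<Delta> r + 2))"
      by (simp add: mult_ac)
  qed
qed

section \<open>Palette sizes under Linial's colour reduction\<close>

definition linial_dist :: "nat \<Rightarrow> nat \<Rightarrow> nat" where
  "linial_dist D q = code_dist (q + 2) (2 * D)"

text \<open>A length above \<open>D\<close> times the distance pushes the bound of
  \<open>refine_conflict\<close> for unit weights below one conflict. The extra letter is the reason
  for \<open>q + 2\<close> in \<open>linial_dist\<close>.\<close>

definition linial_len :: "nat \<Rightarrow> nat \<Rightarrow> nat" where
  "linial_len D q = D * linial_dist D q + 1"

fun palette :: "nat \<Rightarrow> nat \<Rightarrow> nat \<Rightarrow> nat" where
  "palette D q 0 = q"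
| "palette D q (Suc i) = 2 * linial_len D (palette D q i) * linial_len D (palette D q i)"

text \<open>One reduction turns \<open>q\<close> colours into roughly the square of
  \<open>D * log q\<close>, so the scale \<open>l\<close> becomes \<open>log 2 l\<close> while the
  term in \<open>r\<close> and \<open>\<Delta>\<close> reproduces itself. The first condition on
  \<open>C\<close> makes the same constant survive every step.\<close>

lemma palette_step:
  assumes r: "2 \<le> r" and C: "5 + 2 * log 2 (4 * C + 12) \<le> C" "2 \<le> C" and l: "1 < l"
    and q: "log 2 (real q + 1) \<le> C * (l + log_rank_deg r \<Delta>)"
  shows "log 2 (real (palette (r * \<Delta>) q 1) + 1) \<le> C * (log 2 l + log_rank_deg r \<Delta>)"
proof -
  define \<Lambda> where "\<Lambda> = log_rank_deg r \<Delta>"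
  have \<Lambda>: "2 \<le> \<Lambda>" unfolding \<Lambda>_def by (rule log_rank_deg_ge[OF r])
  let ?D = "r * \<Delta>"
  let ?k = "real (linial_dist ?D q)" and ?m = "real (linial_len ?D q)"
  have k0: "1 \<le> ?k" by (simp add: linial_dist_def code_dist_def)
  have "log 2 (real (q + 2) + real (2 * ?D) + 1) \<le> log 2 ((real q + 1) * (2 * (real r * (real \<Delta> + 2))))"
  proof (subst log_le_cancel_iff)
    have a: "real (2 * ?D) + 3 \<le> 2 * (real r * (real \<Delta> + 2))" using r by (simp add: algebra_simps)
    have "real (q + 2) + real (2 * ?D) + 1 \<le> (real q + 1) * (real (2 * ?D) + 3)" by (simp add: algebra_simps)
    also have "\<dots> \<le> (real q + 1) * (2 * (real r * (real \<Delta> + 2)))" using a by (intro mult_left_mono) auto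
    finally show "real (q + 2) + real (2 * ?D) + 1 \<le> (real q + 1) * (2 * (real r * (real \<Delta> + 2)))" .
  qed (use r in \<open>auto intro!: add_pos_nonneg\<close>)
  also have "\<dots> = log 2 (real q + 1) + (1 + \<Lambda>)" using r by (simp add: log_mult \<Lambda>_def)
  finally have "?k \<le> 2 * log 2 (real q + 1) + 6 * \<Lambda>"
    using code_dist_le[of "q + 2" "2 * ?D"] \<Lambda> unfolding linial_dist_def by simp
  also have "\<dots> \<le> 2 * (C * (l + \<Lambda>)) + 6 * (l + \<Lambda>)" using q l unfolding \<Lambda>_def by simp
  also have "\<dots> = (2 * C + 6) * (l + \<Lambda>)" by (simp add: algebra_simps)
  \<comment> \<open>A product instead of a sum, so that the next logarithm splits into
    \<open>log 2 l\<close> and \<open>log 2 \<Lambda>\<close>.\<close>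
  also have "\<dots> \<le> (2 * C + 6) * (2 * (l * \<Lambda>))"
  proof (intro mult_left_mono)
    have "l * 1 \<le> l * \<Lambda>" "1 * \<Lambda> \<le> l * \<Lambda>" using l \<Lambda> by (intro mult_mono; simp)+
    then show "l + \<Lambda> \<le> 2 * (l * \<Lambda>)" by simp
  qed (use C in simp)
  also have "\<dots> = (4 * C + 12) * (l * \<Lambda>)" by simp
  finally have k: "?k \<le> (4 * C + 12) * (l * \<Lambda>)" .
  have "log 2 ?k \<le> log 2 ((4 * C + 12) * (l * \<Lambda>))"
    using k k0 C l \<Lambda> by (subst log_le_cancel_iff) auto
  also have "\<dots> = log 2 (4 * C + 12) + (log 2 l + log 2 \<Lambda>)" using C l \<Lambda> by (simp add: log_mult)
  also have "log 2 \<Lambda> \<le> \<Lambda>" using \<Lambda> by (intro log2_le_self) simp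
  finally have logk: "log 2 ?k \<le> log 2 (4 * C + 12) + log 2 l + \<Lambda>" by simp
  have m: "?m \<le> (real r * (real \<Delta> + 2)) * ?k"
  proof -
    have "?m = real r * real \<Delta> * ?k + 1" by (simp add: linial_len_def)
    moreover have "1 * 1 \<le> (2 * real r) * ?k" using r k0 by (intro mult_mono) auto
    ultimately show ?thesis by (simp add: algebra_simps)
  qed
  have m1: "1 \<le> ?m" by (simp add: linial_len_def)
  have "log 2 ?m \<le> log 2 ((real r * (real \<Delta> + 2)) * ?k)"
    using m m1 by (subst log_le_cancel_iff) auto
  also have "\<dots> = \<Lambda> + log 2 ?k" using r k0 by (simp add: log_mult \<Lambda>_def)
  finally have logm: "log 2 ?m \<le> \<Lambda> + log 2 ?k" .
  have "log 2 (real (palette ?D q 1) + 1) \<le> log 2 (2 ^ 2 * (?m * ?m))"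
  proof (subst log_le_cancel_iff)
    have "1 * 1 \<le> ?m * ?m" using m1 by (intro mult_mono) auto
    then show "real (palette ?D q 1) + 1 \<le> 2 ^ 2 * (?m * ?m)" by simp
  qed (use m1 in \<open>auto intro!: mult_pos_pos add_nonneg_pos\<close>)
  also have "\<dots> = 2 + 2 * log 2 ?m" using m1 log_nat_power[of 2 2 2] by (simp add: log_mult)
  also have "\<dots> \<le> 5 * \<Lambda> + 2 * log 2 (4 * C + 12) + 2 * log 2 l"
    using logm logk \<Lambda> by simp
  also have "\<dots> \<le> C * \<Lambda> + C * log 2 l"
  proof (rule add_mono)
    have "1 \<le> 4 * C + 12" using C by simp
    then have "0 \<le> log 2 (4 * C + 12)" by simp
    then have "log 2 (4 * C + 12) * 1 \<le> log 2 (4 * C + 12) * \<Lambda>" using \<Lambda> by (intro mult_left_mono) auto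
    moreover have "(5 + 2 * log 2 (4 * C + 12)) * \<Lambda> \<le> C * \<Lambda>" using C(1) \<Lambda> by (intro mult_right_mono) auto
    ultimately show "5 * \<Lambda> + 2 * log 2 (4 * C + 12) \<le> C * \<Lambda>" by (simp add: algebra_simps)
    show "2 * log 2 l \<le> C * log 2 l" using C(2) l by (intro mult_right_mono) auto
  qed
  finally show ?thesis unfolding \<Lambda>_def by (simp add: algebra_simps)
qed

text \<open>Gives the \<open>LEAST\<close> in \<open>log_star\<close> a witness. Above
  \<open>2\<close> a logarithm loses at least one unit, so the ceiling decreases.\<close>

lemma iterated_log_le_1: "\<exists>i. ((\<lambda>x. log 2 x) ^^ i) x \<le> 1"
proof (induction "nat \<lceil>x\<rceil>" arbitrary: x rule: less_induct)
  case less
  consider "x \<le> 1" | "1 < x" "x \<le> 2" | "2 < x" by linarith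
  then show ?case
  proof cases
    case 1 then show ?thesis by (intro exI[of _ 0]) simp
  next
    case 2 then show ?thesis by (intro exI[of _ 1]) (use log_le_cancel_iff[of 2 x 2] in simp)
  next
    case 3
    then have "log 2 x \<le> x - 1" by (intro log2_le_minus_one) simp
    then have "nat \<lceil>log 2 x\<rceil> < nat \<lceil>x\<rceil>" using 3 by linarith
    from less[OF this] obtain i where "((\<lambda>x. log 2 x) ^^ i) (log 2 x) \<le> 1" by blast
    then show ?thesis by (intro exI[of _ "Suc i"]) (simp only: funpow_Suc_right comp_def)
  qed
qed

text \<open>Before step \<open>log_star n\<close> the iterated logarithm exceeds \<open>1\<close>,
  so \<open>palette_step\<close> applies; at that step it is at most \<open>1\<close> and only the
  term in \<open>r\<close> and \<open>\<Delta>\<close> is left.\<close>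

lemma palette_le:
  "\<exists>d\<ge>0. \<forall>r \<Delta> n. 2 \<le> r \<longrightarrow>
     log 2 (real (palette (r * \<Delta>) (n ^ b) (log_star n)) + 1) \<le> d * log_rank_deg r \<Delta>"
proof -
  \<comment> \<open>Large enough for the condition of \<open>palette_step\<close>:
    \<open>4 * C + 12\<close> is at most \<open>2 ^ (b + 8)\<close>, while \<open>C\<close> is at
    least \<open>32 * (b + 1)\<close>.\<close>
  define C :: real where "C = 2 ^ (b + 5)"
  have bC: "real b + 1 \<le> C" "32 * (real b + 1) \<le> C"
  proof -
    have "b + 1 \<le> 2 ^ b" by (induction b) auto
    then have "real (b + 1) \<le> real (2 ^ b)" by (rule of_nat_mono)
    then show "32 * (real b + 1) \<le> C" by (simp add: C_def power_add)
    then show "real b + 1 \<le> C" by simp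
  qed
  have C2: "2 \<le> C" using bC(2) by simp
  have "log 2 (4 * C + 12) \<le> log 2 (2 ^ (b + 8))"
    using C2 bC(2) by (subst log_le_cancel_iff) (auto simp: C_def power_add)
  also have "\<dots> = b + 8" by (subst log_nat_power) auto
  finally have C1: "5 + 2 * log 2 (4 * C + 12) \<le> C" using bC(2) by simp
  show ?thesis
  proof (intro exI[of _ "2 * C"] conjI allI impI)
    show "0 \<le> 2 * C" using C2 by simp
    fix r \<Delta> n :: nat assume r: "2 \<le> r"
    let ?\<Lambda> = "log_rank_deg r \<Delta>" and ?ls = "\<lambda>i. ((\<lambda>x. log 2 x) ^^ i) (real n)"
    have \<Lambda>: "2 \<le> ?\<Lambda>" by (rule log_rank_deg_ge[OF r])
    have "log 2 (real (palette (r * \<Delta>) (n ^ b) i) + 1) \<le> C * (?ls i + ?\<Lambda>)" if "i \<le> log_star n" for i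
      using that
    proof (induction i)
      case 0
      have "n ^ b + 1 \<le> 2 * (n + 1) ^ b"
      proof -
        have "n ^ b \<le> (n + 1) ^ b" "1 \<le> (n + 1) ^ b" by (auto intro: power_mono)
        then show ?thesis by linarith
      qed
      then have "real (n ^ b + 1) \<le> real (2 * (n + 1) ^ b)" by (rule of_nat_mono)
      then have "real (n ^ b) + 1 \<le> 2 * (real n + 1) ^ b" by (simp add: add.commute)
      then have "log 2 (real (n ^ b) + 1) \<le> log 2 (2 * (real n + 1) ^ b)"
        by (subst log_le_cancel_iff) (auto intro: add_nonneg_pos)
      also have "\<dots> = 1 + b * log 2 (real n + 1)" by (subst log_mult) (auto simp: log_nat_power)
      finally have l0: "log 2 (real (n ^ b) + 1) \<le> 1 + b * log 2 (real n + 1)" .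
      have "log 2 (real n + 1) \<le> n"
      proof -
        have "n + 1 \<le> 2 ^ n" by (induction n) auto
        then have "real (n + 1) \<le> real (2 ^ n)" by (rule of_nat_mono)
        then show ?thesis by (subst log_le_iff) (auto simp: powr_realpow)
      qed
      then have "1 + b * log 2 (real n + 1) \<le> 1 + b * real n" by (simp add: mult_left_mono)
      also have "1 + b * real n \<le> C * ?\<Lambda> + C * n"
      proof (rule add_mono)
        have "1 * 1 \<le> C * ?\<Lambda>" using C2 \<Lambda> by (intro mult_mono) auto
        then show "1 \<le> C * ?\<Lambda>" by simp
        show "b * real n \<le> C * n" using bC(1) by (intro mult_right_mono) auto
      qed
      finally show ?case using l0 by (simp add: algebra_simps)
    next
      case (Suc i)
      have "1 < ?ls i"
        using not_less_Least[of i "\<lambda>i. ?ls i \<le> 1"] Suc.prems by (simp add: log_star_def not_le)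
      from palette_step[OF r C1 C2 this Suc.IH] Suc.prems show ?case by simp
    qed
    from this[of "log_star n"]
    have "log 2 (real (palette (r * \<Delta>) (n ^ b) (log_star n)) + 1) \<le> C * (?ls (log_star n) + ?\<Lambda>)" by simp
    also have "\<dots> \<le> C * (?\<Lambda> + ?\<Lambda>)"
    proof (intro mult_left_mono add_right_mono)
      have "?ls (log_star n) \<le> 1" unfolding log_star_def by (rule LeastI_ex[OF iterated_log_le_1])
      then show "?ls (log_star n) \<le> ?\<Lambda>" using \<Lambda> by simp
    qed (use C2 in simp)
    finally show "log 2 (real (palette (r * \<Delta>) (n ^ b) (log_star n)) + 1) \<le> 2 * C * ?\<Lambda>" by (simp add: algebra_simps)
  qed
qed

section \<open>Approximation guarantee\<close>

text \<open>All nodes evaluate the same \<open>SOME\<close> term and thus agree on the code without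
  communication.\<close>

fun linial :: "(nat \<Rightarrow> nat set) \<Rightarrow> nat \<Rightarrow> nat \<Rightarrow> (nat \<Rightarrow> nat) \<Rightarrow> nat \<Rightarrow> nat \<Rightarrow> nat" where
  "linial nb D q c 0 = c"
| "linial nb D q c (Suc i) =
     (let p = palette D q i; m = linial_len D p
      in refine nb (\<lambda>_ _. 1) (SOME F. is_code p m (linial_dist D p) F) m (linial nb D q c i))"

lemma linial_code:
  "is_code p (linial_len D p) (linial_dist D p) (SOME F. is_code p (linial_len D p) (linial_dist D p) F)"
proof (rule someI_ex[where P = "is_code p (linial_len D p) (linial_dist D p)"])
  have "p + 2 * linial_len D p < 2 ^ linial_dist D p"
    using code_dist[of "p + 2" "2 * D"] by (simp add: linial_len_def linial_dist_def)
  then show "\<exists>F. is_code p (linial_len D p) (linial_dist D p) F"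
    by (rule exists_code) (simp add: linial_len_def)
qed

text \<open>With unit weights a single monochromatic neighbour would contribute \<open>1\<close> to
  a sum that is bounded by a number below \<open>1\<close>.\<close>

lemma (in conflict_graph) linial_proper:
  assumes deg: "\<And>e. e \<in> E \<Longrightarrow> card (nb e) \<le> D"
    and c: "\<And>e. e \<in> E \<Longrightarrow> c e < q" "\<And>e f. e \<in> E \<Longrightarrow> f \<in> nb e \<Longrightarrow> c f \<noteq> c e"
  shows "(\<forall>e\<in>E. linial nb D q c i e < palette D q i) \<and>
    (\<forall>e\<in>E. \<forall>f\<in>nb e. linial nb D q c i f \<noteq> linial nb D q c i e)"
proof (induction i)
  case 0
  then show ?case using c by auto
next
  case (Suc i)
  let ?c = "linial nb D q c i" and ?p = "palette D q i"
  let ?m = "linial_len D ?p" and ?k = "linial_dist D ?p"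
  let ?F = "SOME F. is_code ?p ?m ?k F"
  let ?W = "\<lambda>_ _. 1 :: real"
  have code: "is_code ?p ?m ?k ?F" by (rule linial_code)
  have m: "0 < ?m" by (simp add: linial_len_def)
  have cl: "?c e < ?p" if "e \<in> E" for e using Suc that by blast
  have "refine nb ?W ?F ?m ?c e < 2 * ?m * ?m" if "e \<in> E" for e
    by (rule refine_less[where W = ?W, OF _ code m cl that]) auto
  moreover have "refine nb ?W ?F ?m ?c f \<noteq> refine nb ?W ?F ?m ?c e" if e: "e \<in> E" and f: "f \<in> nb e" for e f
  proof
    assume eq: "refine nb ?W ?F ?m ?c f = refine nb ?W ?F ?m ?c e"
    let ?S = "\<Sum>f\<in>nb e. if refine nb ?W ?F ?m ?c f = refine nb ?W ?F ?m ?c e then 1 else (0::real)"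
    have "(if refine nb ?W ?F ?m ?c f = refine nb ?W ?F ?m ?c e then 1 else 0) \<le> ?S"
      using f finite_nb[OF e]
      by (intro member_le_sum[where f = "\<lambda>f. if refine nb ?W ?F ?m ?c f = refine nb ?W ?F ?m ?c e then 1 else (0::real)"]) auto
    then have "real ?m * 1 \<le> real ?m * ?S" using eq by (intro mult_left_mono) auto
    also have "\<dots> \<le> real ?k * (\<Sum>f\<in>nb e. 1)"
      by (rule refine_conflict[where W = ?W and c = ?c, OF _ code m cl e]) (use Suc e in auto)
    also have "\<dots> = real (?k * card (nb e))" by simp
    also have "\<dots> \<le> real (?k * D)" using deg[OF e] by (intro of_nat_mono mult_left_mono) auto
    also have "\<dots> < real ?m" by (simp add: linial_len_def)
    finally show False by simp
  qed
  ultimately show ?case by (simp add: Let_def)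
qed

lemma local_linial:
  assumes "local_fun 0 c"
  shows "local_fun i (\<lambda>I. linial (line_nbrs I) D q (c I) i)"
proof (induction i)
  case 0
  then show ?case using assms by simp
next
  case (Suc i)
  show ?case unfolding linial.simps Let_def by (rule local_refine[OF Suc Suc])
qed

section \<open>The line graph and the fractional optimum\<close>

definition bounded_network :: "nat \<Rightarrow> nat \<Rightarrow> network \<Rightarrow> bool" where
  "bounded_network r \<Delta> I \<longleftrightarrow> I \<in> networks \<and> 2 \<le> r \<and> (\<forall>e\<in>edges I. card (incid I e) \<le> r) \<and>
     (\<forall>v\<in>verts I. hdeg (edges I) (incid I) v \<le> \<Delta>) \<and> (\<forall>e\<in>edges I. 0 \<le> wt I e)"

definition line_coloring :: "nat \<Rightarrow> network \<Rightarrow> (nat \<Rightarrow> nat) \<Rightarrow> bool" where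
  "line_coloring q I c \<longleftrightarrow> (\<forall>e\<in>edges I. c e < q \<and> (\<forall>f\<in>line_nbrs I e. c f \<noteq> c e))"

lemma bounded_networkD:
  assumes "bounded_network r \<Delta> I"
  shows "finite (verts I)" "finite (edges I)" "\<And>e. e \<in> edges I \<Longrightarrow> incid I e \<subseteq> verts I"
    "\<And>e. e \<in> edges I \<Longrightarrow> finite (incid I e)" "\<And>e. e \<in> edges I \<Longrightarrow> card (incid I e) \<le> r"
  using assms by (auto simp: bounded_network_def networks_def hypergraph_def intro: finite_subset)

lemma line_graph: "bounded_network r \<Delta> I \<Longrightarrow> weighted_conflict_graph (edges I) (line_nbrs I) (wt I)"
  by unfold_locales (auto simp: bounded_networkD(2) line_nbrs_def bounded_network_def)

lemma card_line_nbrs: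
  assumes I: "bounded_network r \<Delta> I" and e: "e \<in> edges I"
  shows "card (line_nbrs I e) \<le> r * \<Delta>"
proof -
  note H = bounded_networkD[OF I]
  have "line_nbrs I e \<subseteq> (\<Union>v\<in>incid I e. edges_at (edges I) (incid I) v)"
    by (auto simp: line_nbrs_def edges_at_def)
  then have "card (line_nbrs I e) \<le> card (\<Union>v\<in>incid I e. edges_at (edges I) (incid I) v)"
    using H(2) H(4)[OF e] by (intro card_mono) (auto simp: edges_at_def)
  also have "\<dots> \<le> (\<Sum>v\<in>incid I e. card (edges_at (edges I) (incid I) v))" by (rule card_UN_le[OF H(4)[OF e]])
  also have "\<dots> \<le> (\<Sum>v\<in>incid I e. \<Delta>)"
    using I H(3)[OF e] by (intro sum_mono) (auto simp: bounded_network_def hdeg_def)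
  also have "\<dots> \<le> r * \<Delta>" using H(5)[OF e] by simp
  finally show ?thesis .
qed

text \<open>Every edge meeting \<open>e\<close> contains one of its at most \<open>r\<close>
  vertices, and each vertex carries at most \<open>1\<close>.\<close>

lemma frac_matching_closed_nbrs:
  assumes I: "bounded_network r \<Delta> I" and e: "e \<in> edges I"
    and h: "frac_matching (verts I) (edges I) (incid I) h"
  shows "h e + (\<Sum>f\<in>line_nbrs I e. h f) \<le> r"
proof -
  note H = bounded_networkD[OF I]
  have h0: "0 \<le> h f" "h f \<le> 1" if "f \<in> edges I" for f using h that by (auto simp: frac_matching_def)
  have fin: "finite (line_nbrs I e)" using H(2) by (simp add: line_nbrs_def)
  have r: "2 \<le> r" using I by (simp add: bounded_network_def)
  show ?thesis
  proof (cases "incid I e = {}")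
    \<comment> \<open>An empty edge has no vertex to which \<open>h e\<close> could be
      charged.\<close>
    case True
    then have "line_nbrs I e = {}" by (simp add: line_nbrs_def)
    then show ?thesis using h0(2)[OF e] r by simp
  next
    case False
    let ?X = "insert e (line_nbrs I e)"
    have X: "?X \<subseteq> edges I" using e by (auto simp: line_nbrs_def)
    have "h e + (\<Sum>f\<in>line_nbrs I e. h f) = (\<Sum>f\<in>?X. h f)"
      using fin by (simp add: line_nbrs_def)
    also have "\<dots> \<le> (\<Sum>f\<in>?X. \<Sum>v\<in>incid I e. if v \<in> incid I f then h f else 0)"
    proof (rule sum_mono)
      fix f assume f: "f \<in> ?X"
      then obtain v where v: "v \<in> incid I e" "v \<in> incid I f" using False by (auto simp: line_nbrs_def)
      have "(if v \<in> incid I f then h f else 0) \<le> (\<Sum>v\<in>incid I e. if v \<in> incid I f then h f else 0)"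
        using h0(1) f X v H(4)[OF e] by (intro member_le_sum) auto
      then show "h f \<le> (\<Sum>v\<in>incid I e. if v \<in> incid I f then h f else 0)" using v by simp
    qed
    also have "\<dots> \<le> (\<Sum>f\<in>edges I. \<Sum>v\<in>incid I e. if v \<in> incid I f then h f else 0)"
      using h0(1) H(2) X by (intro sum_mono2 sum_nonneg) auto
    also have "\<dots> = (\<Sum>v\<in>incid I e. \<Sum>f\<in>edges I. if v \<in> incid I f then h f else 0)" by (rule sum.swap)
    also have "\<dots> = (\<Sum>v\<in>incid I e. \<Sum>f\<in>edges_at (edges I) (incid I) v. h f)"
      using H(2) by (simp add: edges_at_def sum.inter_filter)
    also have "\<dots> \<le> (\<Sum>v\<in>incid I e. 1)"
      using h H(3)[OF e] by (intro sum_mono) (auto simp: frac_matching_def)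
    also have "\<dots> \<le> real r" using H(5)[OF e] by simp
    finally show ?thesis .
  qed
qed

text \<open>Weighting the cover inequalities by \<open>h\<close> and exchanging the sums multiplies
  each \<open>wt I e * x e\<close> by the mass of \<open>h\<close> on the closed neighbourhood of
  \<open>e\<close>, which is at most \<open>r\<close>.\<close>

lemma frac_opt_le:
  assumes I: "bounded_network r \<Delta> I"
    and cover: "\<And>e. e \<in> edges I \<Longrightarrow> wt I e / 4 \<le> wt I e * x e + (\<Sum>f\<in>line_nbrs I e. wt I f * x f)"
    and x0: "\<And>e. 0 \<le> x e"
  shows "frac_opt (verts I) (edges I) (incid I) (wt I) \<le> 4 * real r * (\<Sum>e\<in>edges I. wt I e * x e)"
  unfolding frac_opt_def
proof (rule cSup_least)
  have "frac_matching (verts I) (edges I) (incid I) (\<lambda>_. 0)" by (simp add: frac_matching_def)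
  then show "{\<Sum>e\<in>edges I. wt I e * h e |h. frac_matching (verts I) (edges I) (incid I) h} \<noteq> {}" by blast
next
  fix y assume "y \<in> {\<Sum>e\<in>edges I. wt I e * h e |h. frac_matching (verts I) (edges I) (incid I) h}"
  then obtain h where h: "frac_matching (verts I) (edges I) (incid I) h" and y: "y = (\<Sum>e\<in>edges I. wt I e * h e)"
    by blast
  interpret weighted_conflict_graph "edges I" "line_nbrs I" "wt I" by (rule line_graph[OF I])
  have h0: "0 \<le> h e" if "e \<in> edges I" for e using h that by (auto simp: frac_matching_def)
  have "y \<le> (\<Sum>e\<in>edges I. 4 * (h e * (wt I e * x e + (\<Sum>f\<in>line_nbrs I e. wt I f * x f))))"
    unfolding y
  proof (rule sum_mono)
    fix e assume e: "e \<in> edges I"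
    show "wt I e * h e \<le> 4 * (h e * (wt I e * x e + (\<Sum>f\<in>line_nbrs I e. wt I f * x f)))"
      using mult_left_mono[OF cover[OF e] h0[OF e]] by (simp add: mult_ac)
  qed
  also have "\<dots> = 4 * ((\<Sum>e\<in>edges I. h e * (wt I e * x e)) + (\<Sum>e\<in>edges I. \<Sum>f\<in>line_nbrs I e. h e * (wt I f * x f)))"
    by (simp add: sum_distrib_left sum.distrib distrib_left)
  also have "(\<Sum>e\<in>edges I. \<Sum>f\<in>line_nbrs I e. h e * (wt I f * x f))
      = (\<Sum>e\<in>edges I. \<Sum>f\<in>line_nbrs I e. h f * (wt I e * x e))"
    by (rule sum_pairs_swap)
  also have "(\<Sum>e\<in>edges I. h e * (wt I e * x e)) + \<dots>
      = (\<Sum>e\<in>edges I. (wt I e * x e) * (h e + (\<Sum>f\<in>line_nbrs I e. h f)))"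
    by (simp add: sum_distrib_left sum_distrib_right sum.distrib distrib_left mult_ac)
  also have "\<dots> \<le> (\<Sum>e\<in>edges I. (wt I e * x e) * r)"
    using a_nonneg x0 frac_matching_closed_nbrs[OF I _ h] by (intro sum_mono mult_left_mono) auto
  finally show "y \<le> 4 * real r * (\<Sum>e\<in>edges I. wt I e * x e)"
    by (simp add: mult_ac flip: sum_distrib_left sum_distrib_right)
qed

section \<open>Assembling the local algorithm\<close>

definition approx_matching :: "nat \<Rightarrow> network \<Rightarrow> nat set \<Rightarrow> bool" where
  "approx_matching r I M \<longleftrightarrow> is_matching (edges I) (incid I) M \<and>
     1 / 16 * frac_opt (verts I) (edges I) (incid I) (wt I) / real r \<le> weight (wt I) M"

text \<open>The guarantee of a single decoder, in a form from which \<open>choice3\<close> collects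
  decoders for all known globals.\<close>

definition decodes :: "nat \<Rightarrow> nat \<Rightarrow> nat \<Rightarrow> (network \<Rightarrow> nat \<Rightarrow> nat) \<Rightarrow> nat \<Rightarrow> (lview \<Rightarrow> bool) \<Rightarrow> bool" where
  "decodes r \<Delta> q c t dec \<longleftrightarrow> (\<forall>I. bounded_network r \<Delta> I \<and> line_coloring q I (c I) \<longrightarrow>
     approx_matching r I {e \<in> edges I. dec (nview I t (Inr e))})"

text \<open>Parametric in a local line colouring found in \<open>s\<close> rounds; the variants with
  and without a given colouring differ only in what is supplied for it.\<close>

lemma exists_local_approx_matching:
  assumes c: "local_fun s c"
  shows "\<exists>dec. decodes r \<Delta> q c (2 * (s + line_rounds r \<Delta> q)) dec"
proof -
  let ?k = "growth_rounds r \<Delta>" and ?k1 = "dist1 r \<Delta> q" and ?m1 = "len1 r \<Delta> q"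
    and ?k2 = "dist2 r \<Delta> q" and ?m2 = "len2 r \<Delta> q"
  have k: "0 < ?k" by (simp add: growth_rounds_def)
  have m: "0 < ?m1" "0 < ?m2" using k by (simp_all add: len1_def len2_def dist1_def dist2_def code_dist_def)
  have "q + 2 * ?m1 < 2 ^ ?k1"
    using code_dist[of q "24 * ?k"] by (simp add: len1_def dist1_def mult_ac)
  from exists_code[OF this m(1)] obtain F1 where F1: "is_code q ?m1 ?k1 F1" ..
  have "2 * ?m1 * ?m1 + 2 * ?m2 < 2 ^ ?k2"
    using code_dist[of "2 * ?m1 * ?m1" "96 * ?k"] by (simp add: len2_def dist2_def mult_ac)
  from exists_code[OF this m(2)] obtain F2 where F2: "is_code (2 * ?m1 * ?m1) ?m2 ?k2 F2" ..
  define x where "x I = rounding (line_nbrs I) (wt I) ?k F1 ?m1 F2 ?m2 ?k2 (c I) ?k" for I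
  define M where "M I = select (line_nbrs I) (wt I) (c I) (x I)" for I
  have "local_fun (Suc (s + ?k + ?k * (1 + 3 * ?m2))) M"
    unfolding M_def x_def by (rule local_select[OF local_mono[OF c] local_rounding[OF c]]) simp
  then have "local_fun (s + line_rounds r \<Delta> q) M" by (simp add: line_rounds_def add.assoc)
  then obtain dec where dec: "\<And>I e. I \<in> networks \<Longrightarrow> e \<in> edges I \<Longrightarrow>
      M I e = dec (nview I (2 * (s + line_rounds r \<Delta> q)) (Inr e))"
    unfolding local_fun_def by blast
  have "approx_matching r I {e \<in> edges I. M I e}"
    if I: "bounded_network r \<Delta> I" and col: "line_coloring q I (c I)" for I
  proof -
    interpret weighted_conflict_graph "edges I" "line_nbrs I" "wt I" by (rule line_graph[OF I])
    have c1: "c I e < q" if "e \<in> edges I" for e using col that by (simp add: line_coloring_def)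
    have c2: "c I f \<noteq> c I e" if "e \<in> edges I" "f \<in> line_nbrs I e" for e f
      using col that by (simp add: line_coloring_def)
    have deg: "2 * card (line_nbrs I e) \<le> 2 ^ ?k" if "e \<in> edges I" for e
    proof -
      have "2 * card (line_nbrs I e) \<le> 2 * r * \<Delta>" using card_line_nbrs[OF I that] by simp
      also have "\<dots> \<le> 2 ^ lg (2 * r * \<Delta>)" by (rule le_power_lg)
      also have "\<dots> \<le> 2 ^ ?k" unfolding growth_rounds_def by simp
      finally show ?thesis .
    qed
    have matching: "is_matching (edges I) (incid I) {e \<in> edges I. M I e}"
      unfolding is_matching_def
    proof (intro conjI ballI impI)
      fix e f assume "e \<in> {e \<in> edges I. M I e}" "f \<in> {e \<in> edges I. M I e}" "e \<noteq> f"
      then have *: "e \<in> edges I" "f \<in> edges I" "e \<noteq> f" "M I e" "M I f" by auto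
      show "incid I e \<inter> incid I f = {}"
      proof (rule ccontr)
        assume "incid I e \<inter> incid I f \<noteq> {}"
        then have "f \<in> line_nbrs I e" using * by (auto simp: line_nbrs_def)
        from select_independent[OF *(1) this c2[OF *(1) this]] *(4,5) show False by (simp add: M_def)
      qed
    qed auto
    have "(\<Sum>e\<in>edges I. wt I e * grow (line_nbrs I) (wt I) ?k ?k e) \<le> 4 * weight (wt I) {e \<in> edges I. M I e}"
      unfolding M_def x_def weight_def
      by (rule select_weight[OF c1 c2 k deg F1 m(1) _ F2 m(2)]) (simp_all add: len1_def len2_def)
    then have "4 * real r * (\<Sum>e\<in>edges I. wt I e * grow (line_nbrs I) (wt I) ?k ?k e)
        \<le> 4 * real r * (4 * weight (wt I) {e \<in> edges I. M I e})"
      by (intro mult_left_mono) auto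
    moreover have "frac_opt (verts I) (edges I) (incid I) (wt I)
        \<le> 4 * real r * (\<Sum>e\<in>edges I. wt I e * grow (line_nbrs I) (wt I) ?k ?k e)"
      by (rule frac_opt_le[OF I _ less_imp_le[OF grow_pos]]) (rule grow_load)
    \<comment> \<open>The two factors \<open>4\<close>, from the load bound and from the rounding,
      produce the constant \<open>1 / 16\<close>.\<close>
    ultimately have "frac_opt (verts I) (edges I) (incid I) (wt I) \<le> 4 * real r * (4 * weight (wt I) {e \<in> edges I. M I e})"
      by linarith
    with matching show ?thesis
      using I unfolding approx_matching_def by (simp add: bounded_network_def field_simps)
  qed
  moreover have "{e \<in> edges I. M I e} = {e \<in> edges I. dec (nview I (2 * (s + line_rounds r \<Delta> q)) (Inr e))}"
    if "bounded_network r \<Delta> I" for I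
    using dec[of I] that by (auto simp: bounded_network_def)
  ultimately show ?thesis unfolding decodes_def by (intro exI[of _ dec]) auto
qed

lemma choice3: "(\<And>x y z. \<exists>w. P x y z w) \<Longrightarrow> \<exists>f. \<forall>x y z. P x y z (f x y z)"
  by metis

abbreviation instance_of where
  "instance_of V E inc ids col a \<equiv>
     \<lparr>verts = V, edges = E, incid = inc, node_id = ids, node_col = col, wt = a\<rparr>"

lemma valid_instance_bounded_network:
  "valid_instance k n \<Delta> r V E inc a ids \<Longrightarrow> bounded_network r \<Delta> (instance_of V E inc ids col a)"
  by (auto simp: valid_instance_def bounded_network_def networks_def)

text \<open>Edges with a common vertex are at distance two in the incidence graph, hence adjacent in
  its square.\<close>

lemma good_coloring_line_coloring:
  assumes "good_coloring d V E inc r \<Delta> col" "\<And>e. e \<in> E \<Longrightarrow> inc e \<subseteq> V"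
  shows "line_coloring ((r + \<Delta>) ^ d) (instance_of V E inc ids col' a) (\<lambda>e. col (Inr e))"
  unfolding line_coloring_def
proof (intro ballI conjI; simp)
  fix e assume e: "e \<in> E"
  show "col (Inr e) < (r + \<Delta>) ^ d" using assms(1) e by (auto simp: good_coloring_def inc_nodes_def)
  fix f assume "f \<in> line_nbrs (instance_of V E inc ids col' a) e"
  then obtain v where f: "f \<in> E" "f \<noteq> e" "v \<in> inc e" "v \<in> inc f" by (auto simp: line_nbrs_def)
  then have v: "v \<in> V" using assms(2)[OF e] by blast
  have "inc_sq_adj V E inc (Inr f) (Inr e)"
    unfolding inc_sq_adj_def using f v e
    by (auto simp: inc_adj_def inc_nodes_def intro!: disjI2 bexI[of _ "Inl v"])
  then show "col (Inr f) \<noteq> col (Inr e)"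
    using assms(1) e f(1) by (auto simp: good_coloring_def inc_nodes_def)
qed

lemma id_line_coloring:
  assumes "valid_instance k n \<Delta> r V E inc a ids"
  shows "line_coloring (n ^ k) (instance_of V E inc ids col a) (\<lambda>e. ids (Inr e))"
  using assms by (auto simp: line_coloring_def valid_instance_def inc_nodes_def line_nbrs_def dest: inj_onD)

theorem theorem1p1:
  shows "\<exists>c::real. c > 0 \<and>
    (\<forall>(idexp::nat) (colexp::nat). \<exists>(T1::nat \<Rightarrow> nat \<Rightarrow> nat \<Rightarrow> nat) out1
        (T2::nat \<Rightarrow> nat \<Rightarrow> nat \<Rightarrow> nat) out2 (K::real) (j::nat).
      (\<forall>n \<Delta> r. 2 \<le> r \<longrightarrow> real (T1 n \<Delta> r) \<le> soft_O_bound K j (base_term \<Delta> r)) \<and>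
      (\<forall>n \<Delta> r. 2 \<le> r \<longrightarrow>
          real (T2 n \<Delta> r) \<le> soft_O_bound K j (base_term \<Delta> r + real (log_star n))) \<and>
      (\<forall>n \<Delta> r V E inc a ids col.
          valid_instance idexp n \<Delta> r V E inc a ids \<and> good_coloring colexp V E inc r \<Delta> col \<longrightarrow>
          (let M = local_output T1 out1 n \<Delta> r V E inc ids (\<lambda>x. Some (col x)) a in
             is_matching E inc M \<and> weight a M \<ge> c * frac_opt V E inc a / real r)) \<and>
      (\<forall>n \<Delta> r V E inc a ids.
          valid_instance idexp n \<Delta> r V E inc a ids \<longrightarrow>
          (let M = local_output T2 out2 n \<Delta> r V E inc ids (\<lambda>x. None) a in
             is_matching E inc M \<and> weight a M \<ge> c * frac_opt V E inc a / real r)))"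
proof (intro exI[of _ "1 / 16 :: real"] conjI allI)
  show "(0::real) < 1 / 16" by simp
  fix idexp colexp :: nat
  \<comment> \<open>The first algorithm reads the supplied colours; the second computes a line
    colouring from the identifiers in \<open>log_star n\<close> steps.\<close>
  let ?c1 = "\<lambda>I e. the (node_col I (Inr e))"
  let ?c2 = "\<lambda>n \<Delta> r I. linial (line_nbrs I) (r * \<Delta>) (n ^ idexp) (\<lambda>e. node_id I (Inr e)) (log_star n)"
  let ?q1 = "\<lambda>\<Delta> r. (r + \<Delta>) ^ colexp" and ?q2 = "\<lambda>n \<Delta> r. palette (r * \<Delta>) (n ^ idexp) (log_star n)"
  let ?T1 = "\<lambda>(n::nat) \<Delta> r. 2 * (0 + line_rounds r \<Delta> (?q1 \<Delta> r))"
  let ?T2 = "\<lambda>n \<Delta> r. 2 * (log_star n + line_rounds r \<Delta> (?q2 n \<Delta> r))"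
  have "\<exists>out1. \<forall>n \<Delta> r. decodes r \<Delta> (?q1 \<Delta> r) ?c1 (?T1 n \<Delta> r) (out1 n \<Delta> r)"
    by (rule choice3, rule exists_local_approx_matching, rule local_map[OF local_color])
  then obtain out1 where out1: "\<And>n \<Delta> r. decodes r \<Delta> (?q1 \<Delta> r) ?c1 (?T1 n \<Delta> r) (out1 n \<Delta> r)" by blast
  have "\<exists>out2. \<forall>n \<Delta> r. decodes r \<Delta> (?q2 n \<Delta> r) (?c2 n \<Delta> r) (?T2 n \<Delta> r) (out2 n \<Delta> r)"
    by (rule choice3, rule exists_local_approx_matching, rule local_linial[OF local_id])
  then obtain out2 where out2: "\<And>n \<Delta> r. decodes r \<Delta> (?q2 n \<Delta> r) (?c2 n \<Delta> r) (?T2 n \<Delta> r) (out2 n \<Delta> r)" by blast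
  obtain d where d: "0 \<le> d" "\<And>r \<Delta> n. 2 \<le> r \<Longrightarrow> log 2 (real (?q2 n \<Delta> r) + 1) \<le> d * log_rank_deg r \<Delta>"
    using palette_le by blast
  \<comment> \<open>One constant for both palettes: \<open>d\<close> covers the computed one,
    \<open>colexp + 1\<close> the \<open>(r + \<Delta>) ^ colexp\<close> supplied colours.\<close>
  define d' where "d' = d + colexp + 1"
  have d': "0 \<le> d'" using d(1) by (simp add: d'_def)
  from line_rounds_le[OF this] obtain K where K: "0 < K" "\<And>r \<Delta> q. 2 \<le> r \<Longrightarrow> log 2 (real q + 1) \<le> d' * log_rank_deg r \<Delta> \<Longrightarrow>
      real (line_rounds r \<Delta> q) \<le> K * (base_term \<Delta> r * log 2 (base_term \<Delta> r + 2))" by blast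
  \<comment> \<open>Each line-graph round costs two rounds on the incidence graph:
    \<open>2 * K\<close> covers \<open>line_rounds\<close>, and the added \<open>2\<close> covers
    \<open>log_star n\<close>.\<close>
  let ?K = "2 * K + 2"
  have base: "0 \<le> base_term \<Delta> r" for \<Delta> r by (simp add: base_term_def)
  have bound1: "real (?T1 n \<Delta> r) \<le> soft_O_bound ?K 1 (base_term \<Delta> r)" if r: "2 \<le> r" for n \<Delta> r
  proof -
    have \<Lambda>: "2 \<le> log_rank_deg r \<Delta>" by (rule log_rank_deg_ge[OF r])
    have le: "real r + real \<Delta> \<le> real r * (real \<Delta> + 2)"
    proof -
      have "1 * real \<Delta> \<le> real r * real \<Delta>" using r by (intro mult_right_mono) auto
      then show ?thesis by (simp add: algebra_simps)
    qed
    have p1: "1 \<le> (real r + real \<Delta>) ^ colexp" using r by (intro one_le_power) simp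
    have "log 2 (real (?q1 \<Delta> r) + 1) \<le> log 2 (2 * (real r + real \<Delta>) ^ colexp)"
      using p1 by (subst log_le_cancel_iff) (auto intro: add_nonneg_pos)
    also have "\<dots> = 1 + colexp * log 2 (real r + real \<Delta>)"
      using r by (subst log_mult_pos) (auto simp: log_nat_power)
    also have "\<dots> \<le> 1 * log_rank_deg r \<Delta> + colexp * log_rank_deg r \<Delta>"
      using \<Lambda> r log_le_log_rank_deg[OF r _ le] by (intro add_mono mult_left_mono) auto
    also have "\<dots> \<le> d' * log_rank_deg r \<Delta>"
      using mult_nonneg_nonneg[OF d(1), of "log_rank_deg r \<Delta>"] \<Lambda> by (simp add: d'_def algebra_simps)
    finally have "real (line_rounds r \<Delta> (?q1 \<Delta> r)) \<le> K * (base_term \<Delta> r * log 2 (base_term \<Delta> r + 2))"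
      by (rule K(2)[OF r])
    moreover have "0 \<le> base_term \<Delta> r * log 2 (base_term \<Delta> r + 2)"
      using base[of \<Delta> r] by (intro mult_nonneg_nonneg) auto
    ultimately show ?thesis unfolding soft_O_bound_def by (simp add: algebra_simps)
  qed
  have bound2: "real (?T2 n \<Delta> r) \<le> soft_O_bound ?K 1 (base_term \<Delta> r + real (log_star n))" if r: "2 \<le> r" for n \<Delta> r
  proof -
    let ?b = "base_term \<Delta> r" and ?s = "real (log_star n)"
    have \<Lambda>: "2 \<le> log_rank_deg r \<Delta>" by (rule log_rank_deg_ge[OF r])
    have "d * log_rank_deg r \<Delta> \<le> d' * log_rank_deg r \<Delta>"
      using \<Lambda> by (intro mult_right_mono) (auto simp: d'_def)
    moreover have "log 2 (real (?q2 n \<Delta> r) + 1) \<le> d * log_rank_deg r \<Delta>" by (rule d(2)[OF r])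
    ultimately have "real (line_rounds r \<Delta> (?q2 n \<Delta> r)) \<le> K * (?b * log 2 (?b + 2))"
      by (intro K(2)[OF r]) simp
    also have "\<dots> \<le> K * ((?b + ?s) * log 2 (?b + ?s + 2))"
      using K(1) base[of \<Delta> r] by (intro mult_left_mono mult_mono) auto
    finally have 1: "real (line_rounds r \<Delta> (?q2 n \<Delta> r)) \<le> K * ((?b + ?s) * log 2 (?b + ?s + 2))" .
    have "1 \<le> log 2 (?b + ?s + 2)" using base[of \<Delta> r] by (subst le_log_iff) auto
    then have "?s * 1 \<le> (?b + ?s) * log 2 (?b + ?s + 2)" using base[of \<Delta> r] by (intro mult_mono) auto
    with 1 show ?thesis unfolding soft_O_bound_def by (simp add: algebra_simps)
  qed
  show "\<exists>(T1::nat \<Rightarrow> nat \<Rightarrow> nat \<Rightarrow> nat) out1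
        (T2::nat \<Rightarrow> nat \<Rightarrow> nat \<Rightarrow> nat) out2 (K::real) (j::nat).
      (\<forall>n \<Delta> r. 2 \<le> r \<longrightarrow> real (T1 n \<Delta> r) \<le> soft_O_bound K j (base_term \<Delta> r)) \<and>
      (\<forall>n \<Delta> r. 2 \<le> r \<longrightarrow>
          real (T2 n \<Delta> r) \<le> soft_O_bound K j (base_term \<Delta> r + real (log_star n))) \<and>
      (\<forall>n \<Delta> r V E inc a ids col.
          valid_instance idexp n \<Delta> r V E inc a ids \<and> good_coloring colexp V E inc r \<Delta> col \<longrightarrow>
          (let M = local_output T1 out1 n \<Delta> r V E inc ids (\<lambda>x. Some (col x)) a in
             is_matching E inc M \<and> weight a M \<ge> 1 / 16 * frac_opt V E inc a / real r)) \<and>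
      (\<forall>n \<Delta> r V E inc a ids.
          valid_instance idexp n \<Delta> r V E inc a ids \<longrightarrow>
          (let M = local_output T2 out2 n \<Delta> r V E inc ids (\<lambda>x. None) a in
             is_matching E inc M \<and> weight a M \<ge> 1 / 16 * frac_opt V E inc a / real r))"
  proof (rule exI[of _ ?T1], rule exI[of _ out1], rule exI[of _ ?T2], rule exI[of _ out2],
      rule exI[of _ ?K], rule exI[of _ 1], intro conjI allI impI)
    show "real (?T1 n \<Delta> r) \<le> soft_O_bound ?K 1 (base_term \<Delta> r)" if "2 \<le> r" for n \<Delta> r
      by (rule bound1[OF that])
    show "real (?T2 n \<Delta> r) \<le> soft_O_bound ?K 1 (base_term \<Delta> r + real (log_star n))" if "2 \<le> r" for n \<Delta> r
      by (rule bound2[OF that])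
  next
    fix n \<Delta> r V E inc a ids col
    assume *: "valid_instance idexp n \<Delta> r V E inc a ids \<and> good_coloring colexp V E inc r \<Delta> col"
    let ?I = "instance_of V E inc ids (\<lambda>x. Some (col x)) a"
    have "bounded_network r \<Delta> ?I" using * by (blast intro: valid_instance_bounded_network)
    moreover have "line_coloring (?q1 \<Delta> r) ?I (?c1 ?I)"
      using * good_coloring_line_coloring[of colexp V E inc r \<Delta> col ids "\<lambda>x. Some (col x)" a]
      by (simp add: valid_instance_def hypergraph_def)
    ultimately have "approx_matching r ?I {e \<in> edges ?I. out1 n \<Delta> r (nview ?I (?T1 n \<Delta> r) (Inr e))}"
      using out1[of r \<Delta> n] unfolding decodes_def by blast
    then show "let M = local_output ?T1 out1 n \<Delta> r V E inc ids (\<lambda>x. Some (col x)) a in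
        is_matching E inc M \<and> weight a M \<ge> 1 / 16 * frac_opt V E inc a / real r"
      by (simp add: approx_matching_def nview_def local_output_def Let_def)
  next
    fix n \<Delta> r V E inc a ids
    assume *: "valid_instance idexp n \<Delta> r V E inc a ids"
    let ?I = "instance_of V E inc ids (\<lambda>x. None) a"
    have I: "bounded_network r \<Delta> ?I" using * by (blast intro: valid_instance_bounded_network)
    interpret weighted_conflict_graph E "line_nbrs ?I" a using line_graph[OF I] by simp
    have "line_coloring (?q2 n \<Delta> r) ?I (?c2 n \<Delta> r ?I)"
      using linial_proper[of "r * \<Delta>" "\<lambda>e. ids (Inr e)" "n ^ idexp" "log_star n"]
        card_line_nbrs[OF I] id_line_coloring[OF *, of "\<lambda>x. None"]
      by (simp add: line_coloring_def)
    with I out2[of r \<Delta> n] have "approx_matching r ?I {e \<in> edges ?I. out2 n \<Delta> r (nview ?I (?T2 n \<Delta> r) (Inr e))}"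
      unfolding decodes_def by blast
    then show "let M = local_output ?T2 out2 n \<Delta> r V E inc ids (\<lambda>x. None) a in
        is_matching E inc M \<and> weight a M \<ge> 1 / 16 * frac_opt V E inc a / real r"
      by (simp add: approx_matching_def nview_def local_output_def Let_def)
  qed
qed

end
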